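(* Let $m,n\ge 1$ and let $\mathbb{C}(x_i^j)$ be the field of rational functions in the $mn$ indeterminates $x_i^j$ ($i\in[m]$, $j\in[n]$). Let $M(\mathbf{x})=W(\mathbf{x}_1)\cdots W(\mathbf{x}_m)$ (an $n\times n$ matrix). (1) The non-trivial entries of $M(\mathbf{x})$ (i.e. those that are not identically $0$ or $1$) are algebraically independent over $\mathbb{C}$ and generate the subfield ${\rm Inv}_e\subset\mathbb{C}(x_i^j)$ of invariants of the geometric crystal operators $e_1,\dots,e_{m-1}$. (2) The non-trivial entries of $M(\mathbf{x})$ generate the subring ${\rm Inv}_e\cap\mathbb{C}[x_i^j]$ of polynomial invariants of the $e_i$.
   Context: For $\mathbf{x}=(x_i^j)_{i\in[m]}^{j\in[n]}$ an $m\times n$ matrix, write $\mathbf{x}_i=(x_i^1,\dots,x_i^n)$ for its $i$th row. For $u=(u^1,\dots,u^n)$, $v=(v^1,\dots,v^n)$, $c\in\mathbb{C}^*$ and $j\in[0,n]$ set $\sigma^j(u,v;c)=\sum_{r=1}^n c^{\mathbb{1}_{r\le j}}v^1\cdots v^{r-1}u^{r+1}\cdots u^n$. For $i\in[m-1]$ and $c\in\mathbb{C}^*$, the geometric crystal operator $e_i^c$ is the rational map on $m\times n$ matrices over $\mathbb{C}^*$ which leaves all rows other than $i,i+1$ unchanged and replaces $x_i^j$ by $\frac{\sigma^j(\mathbf{x}_i,\mathbf{x}_{i+1};c)}{\sigma^{j-1}(\mathbf{x}_i,\mathbf{x}_{i+1};c)}x_i^j$ and $x_{i+1}^j$ by $\frac{\sigma^{j-1}(\mathbf{x}_i,\mathbf{x}_{i+1};c)}{\sigma^{j}(\mathbf{x}_i,\mathbf{x}_{i+1};c)}x_{i+1}^j$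 for $j\in[n]$. ${\rm Inv}_e$ is the set of $f\in\mathbb{C}(x_i^j)$ with $f\circ e_i^c=f$ (as rational functions of $\mathbf{x}$ and $c$) for all $i\in[m-1]$. For $y_1,\dots,y_n\in\mathbb{C}^*$, $W(y_1,\dots,y_n)$ is the $n\times n$ matrix with $y_1,\dots,y_n$ on the main diagonal, $1$'s directly below the main diagonal, and $0$'s elsewhere. *)

theory Defs
  imports Complex_Main "HOL-Library.Poly_Mapping" "HOL-Library.Option_ord" "HOL-Library.Product_Lexorder"
          "HOL-Computational_Algebra.Fraction_Field"
begin

type_synonym 'v cpoly = "('v \<Rightarrow>\<^sub>0 nat) \<Rightarrow>\<^sub>0 complex"

text \<open>Variables: Some (i,j) is the indeterminate x_i^j; None is the extra
  parameter c of the crystal operators.\<close>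
type_synonym var = "(nat \<times> nat) option"

type_synonym rfun = "var cpoly fract"

definition pvar :: "'v \<Rightarrow> 'v cpoly" where
  "pvar v = Poly_Mapping.single (Poly_Mapping.single v 1) 1"

definition pconst :: "complex \<Rightarrow> 'v cpoly" where
  "pconst a = Poly_Mapping.single 0 a"

definition pvars :: "'v cpoly \<Rightarrow> 'v set" where
  "pvars p = \<Union> (Poly_Mapping.keys ` Poly_Mapping.keys p)"

definition peval :: "(complex \<Rightarrow> 'b::comm_ring_1) \<Rightarrow> ('v \<Rightarrow> 'b) \<Rightarrow> 'v cpoly \<Rightarrow> 'b" where
  "peval h a p = (\<Sum>t\<in>Poly_Mapping.keys p. h (Poly_Mapping.lookup p t) * (\<Prod>v\<in>Poly_Mapping.keys t. a v ^ Poly_Mapping.lookup t v))"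

definition cst :: "complex \<Rightarrow> rfun" where
  "cst z = Fract (pconst z) 1"

definition rpoly :: "var cpoly \<Rightarrow> rfun" where
  "rpoly p = Fract p 1"

definition xv :: "nat \<Rightarrow> nat \<Rightarrow> rfun" where
  "xv i j = rpoly (pvar (Some (i, j)))"

definition cv :: rfun where
  "cv = rpoly (pvar None)"

definition Xvars :: "nat \<Rightarrow> nat \<Rightarrow> var set" where
  "Xvars m n = {Some (i, j) | i j. i \<in> {1..m} \<and> j \<in> {1..n}}"

definition RatF :: "nat \<Rightarrow> nat \<Rightarrow> rfun set" where
  "RatF m n = {Fract p q | p q. q \<noteq> 0 \<and> pvars p \<subseteq> Xvars m n \<and> pvars q \<subseteq> Xvars m n}"

definition PolR :: "nat \<Rightarrow> nat \<Rightarrow> rfun set" where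
  "PolR m n = {rpoly p | p. pvars p \<subseteq> Xvars m n}"

definition sigma :: "nat \<Rightarrow> (nat \<Rightarrow> 'a::field) \<Rightarrow> (nat \<Rightarrow> 'a) \<Rightarrow> 'a \<Rightarrow> nat \<Rightarrow> 'a" where
  "sigma n u v c j = (\<Sum>r\<in>{1..n}. (if r \<le> j then c else 1) *
      (\<Prod>s\<in>{1..<r}. v s) * (\<Prod>s\<in>{r<..n}. u s))"

definition ecrys :: "nat \<Rightarrow> nat \<Rightarrow> 'a::field \<Rightarrow> (nat \<Rightarrow> nat \<Rightarrow> 'a) \<Rightarrow> (nat \<Rightarrow> nat \<Rightarrow> 'a)" where
  "ecrys n i c x = (\<lambda>k j.
     if k = i then sigma n (x i) (x (i+1)) c j / sigma n (x i) (x (i+1)) c (j - 1) * x i j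
     else if k = i + 1 then sigma n (x i) (x (i+1)) c (j - 1) / sigma n (x i) (x (i+1)) c j * x (i+1) j
     else x k j)"

definition esubst :: "nat \<Rightarrow> nat \<Rightarrow> var cpoly \<Rightarrow> rfun" where
  "esubst n i p = peval cst
     (\<lambda>v. case v of Some (k, j) \<Rightarrow> ecrys n i cv xv k j | None \<Rightarrow> cv) p"

text \<open>f \<circ> e_i^c = f as rational functions of x and c; f = p/q is any
  representation of f by polynomials in the x_i^j.\<close>
definition e_invariant :: "nat \<Rightarrow> nat \<Rightarrow> nat \<Rightarrow> rfun \<Rightarrow> bool" where
  "e_invariant m n i f \<longleftrightarrow>
     (\<forall>p q. q \<noteq> 0 \<longrightarrow> pvars p \<subseteq> Xvars m n \<longrightarrow> pvars q \<subseteq> Xvars m n \<longrightarrow> f = Fract p q \<longrightarrow>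
        esubst n i p / esubst n i q = f)"

definition Inv_e :: "nat \<Rightarrow> nat \<Rightarrow> rfun set" where
  "Inv_e m n = {f \<in> RatF m n. \<forall>i\<in>{1..m-1}. e_invariant m n i f}"

definition Wmat :: "(nat \<Rightarrow> 'a::comm_ring_1) \<Rightarrow> nat \<Rightarrow> nat \<Rightarrow> 'a" where
  "Wmat y a b = (if a = b then y a else if a = b + 1 then 1 else 0)"

definition mmul :: "nat \<Rightarrow> (nat \<Rightarrow> nat \<Rightarrow> 'a::comm_ring_1) \<Rightarrow> (nat \<Rightarrow> nat \<Rightarrow> 'a) \<Rightarrow> nat \<Rightarrow> nat \<Rightarrow> 'a" where
  "mmul n A B a b = (\<Sum>k\<in>{1..n}. A a k * B k b)"

fun Wprod :: "nat \<Rightarrow> (nat \<Rightarrow> nat \<Rightarrow> 'a::comm_ring_1) \<Rightarrow> nat \<Rightarrow> nat \<Rightarrow> nat \<Rightarrow> 'a" where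
  "Wprod n x 0 = (\<lambda>a b. if a = b then 1 else 0)"
| "Wprod n x (Suc k) = mmul n (Wprod n x k) (Wmat (x (Suc k)))"

definition Mx :: "nat \<Rightarrow> nat \<Rightarrow> nat \<Rightarrow> nat \<Rightarrow> rfun" where
  "Mx m n = Wprod n xv m"

definition nontriv :: "nat \<Rightarrow> nat \<Rightarrow> (nat \<times> nat) set" where
  "nontriv m n = {(a, b) | a b. a \<in> {1..n} \<and> b \<in> {1..n} \<and> Mx m n a b \<noteq> 0 \<and> Mx m n a b \<noteq> 1}"

definition alg_indep :: "('i \<Rightarrow> rfun) \<Rightarrow> 'i set \<Rightarrow> bool" where
  "alg_indep g E \<longleftrightarrow> (\<forall>P :: 'i cpoly. pvars P \<subseteq> E \<longrightarrow> peval cst g P = 0 \<longrightarrow> P = 0)"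

definition gen_field :: "('i \<Rightarrow> rfun) \<Rightarrow> 'i set \<Rightarrow> rfun set" where
  "gen_field g E = {peval cst g P / peval cst g Q | P Q :: 'i cpoly.
      pvars P \<subseteq> E \<and> pvars Q \<subseteq> E \<and> peval cst g Q \<noteq> 0}"

definition gen_ring :: "('i \<Rightarrow> rfun) \<Rightarrow> 'i set \<Rightarrow> rfun set" where
  "gen_ring g E = {peval cst g P | P :: 'i cpoly. pvars P \<subseteq> E}"

end

theory Submission
  imports Defs "HOL-Computational_Algebra.Polynomial"
begin

text \<open>
  The crystal operator preserves x_i^j x_{i+1}^j and x_{i+1}^j + x_i^{j+1}, which are all that the
  product W(x_i) W(x_{i+1}) depends on; so the entries of M are invariant. Ordering the variables by
  column, an entry of M is affine in one new variable over the earlier ones, which gives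
  algebraic independence.

  For the converse let F_k be the field generated by the entries of W(x_1)...W(x_k) and the
  variables of the rows beyond k, so that F_1 is the field of all rational functions and F_m is the
  field generated by the entries of M. An f in F_k that is invariant under e_k lies in F_{k+1}: F_k
  is generated over F_{k+1} by some entries v_b of row k+1, and e_k maps f = f(v) to f(t), with t_b
  the image of v_b. The t_b are algebraically independent over F_k, as follows from the Moebius
  dependence of t_n on c and from t_b = v_b + u_{b+1} (t_{b+1} - v_{b+1}) / t_{b+1} with u the row k.
  As f(t) = f is in F_k, no t_b occurs in it.

  For polynomial invariants the generators are exchanged one at a time, keeping track of the
  elements which become polynomial after multiplication with a power of v_b.
\<close>

section \<open>Polynomials and ring homomorphisms\<close>

text \<open>Invariance becomes rationality through one fact: if t is transcendental over K and k is
  a subfield of K, then k(t) and K meet in k. With K generated by F_k and the t_b of larger index,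
  and k by F_{k+1} and the same t_b, the t_b are struck off one at a time. The v_b would not do, as
  they lie in F_k.

  The obstacle for polynomials is that an old entry is multiplied by v_b on its way to a new one, so
  the exchange of generators can be undone only up to denominators v_b^r. They are harmless for one
  of two reasons. If column b gains no nontrivial entry, v_b is a free variable over the generators
  treated before. Otherwise v_b = z - \<rho> with z the new entry in row b + k and \<rho> an old
  entry of column b + 1. This \<rho> is transcendental over the field of the new generators used so
  far, so no nonzero polynomial in z over that field is divisible by z - \<rho>. The transcendence
  of \<rho> is again due to e_k, which fixes F_{k+1} and sends v_b to an element transcendental over
  all rational functions of x.\<close>

lemma sum_single_keys: "(\<Sum>t\<in>Poly_Mapping.keys p. Poly_Mapping.single t (Poly_Mapping.lookup p t)) = p"
  for p :: "'a \<Rightarrow>\<^sub>0 'b::comm_monoid_add"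
proof (rule poly_mapping_eqI)
  fix k
  show "Poly_Mapping.lookup (\<Sum>t\<in>Poly_Mapping.keys p. Poly_Mapping.single t (Poly_Mapping.lookup p t)) k
      = Poly_Mapping.lookup p k"
    by (auto simp: lookup_sum lookup_single when_def in_keys_iff)
qed

lemma pvars_add: "pvars (p + q) \<subseteq> pvars p \<union> pvars q"
  using keys_add[of p q] by (auto simp: pvars_def)

lemma pvars_mult: "pvars (p * q) \<subseteq> pvars p \<union> pvars q"
proof
  fix v assume "v \<in> pvars (p * q)"
  then obtain t where t: "t \<in> Poly_Mapping.keys (p * q)" "v \<in> Poly_Mapping.keys t"
    by (auto simp: pvars_def)
  from t(1) keys_mult[of p q] obtain s r where
    "s \<in> Poly_Mapping.keys p" "r \<in> Poly_Mapping.keys q" "t = s + r" by blast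
  with t(2) keys_add[of s r] show "v \<in> pvars p \<union> pvars q" by (auto simp: pvars_def)
qed

lemma pvars_pconst [simp]: "pvars (pconst c) = {}"
  by (auto simp: pvars_def pconst_def)

lemma pvars_pvar [simp]: "pvars (pvar v) = {v}"
  by (auto simp: pvars_def pvar_def)

lemma pconst_0 [simp]: "pconst 0 = 0" and pconst_1 [simp]: "pconst 1 = 1"
  by (simp_all add: pconst_def)

lemma pconst_add: "pconst (a + b) = pconst a + pconst b"
  and pconst_mult: "pconst (a * b) = pconst a * pconst b"
  by (simp_all add: pconst_def single_add mult_single)

lemma pvars_0 [simp]: "pvars 0 = {}" and pvars_1 [simp]: "pvars 1 = {}"
  by (auto simp: pvars_def)

lemma pvars_sum: "(\<And>a. a \<in> A \<Longrightarrow> pvars (f a) \<subseteq> E) \<Longrightarrow> pvars (sum f A) \<subseteq> E"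
proof (induction A rule: infinite_finite_induct)
  case (insert x F)
  then have "pvars (f x) \<subseteq> E" "pvars (sum f F) \<subseteq> E" by auto
  with insert.hyps show ?case using pvars_add[of "f x" "sum f F"] by auto
qed auto

lemma pvars_prod: "(\<And>a. a \<in> A \<Longrightarrow> pvars (f a) \<subseteq> E) \<Longrightarrow> pvars (prod f A) \<subseteq> E"
proof (induction A rule: infinite_finite_induct)
  case (insert x F)
  then have "pvars (f x) \<subseteq> E" "pvars (prod f F) \<subseteq> E" by auto
  with insert.hyps show ?case using pvars_mult[of "f x" "prod f F"] by auto
qed auto

lemma single_power: "Poly_Mapping.single (Poly_Mapping.single v k) (1::complex) = pvar v ^ k"
proof (induction k)
  case (Suc k)
  have "Poly_Mapping.single v (Suc k) = Poly_Mapping.single v 1 + Poly_Mapping.single v k"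
    by (simp flip: single_add)
  then have "Poly_Mapping.single (Poly_Mapping.single v (Suc k)) (1::complex) =
      pvar v * Poly_Mapping.single (Poly_Mapping.single v k) 1"
    by (simp add: pvar_def mult_single)
  with Suc show ?case by simp
qed simp

text \<open>Polynomials in the variables of \<open>E\<close> arise from constants and variables by
  sums and products that never leave \<open>E\<close>. Carrying \<open>pvars\<close> along makes it
  enough to check homomorphisms and memberships on generators.\<close>

lemma cpoly_induct [consumes 1, case_names const var add mult]:
  assumes "pvars p \<subseteq> E"
    and const: "\<And>c. P (pconst c)"
    and var: "\<And>v. v \<in> E \<Longrightarrow> P (pvar v)"
    and add: "\<And>p q. pvars p \<subseteq> E \<Longrightarrow> pvars q \<subseteq> E \<Longrightarrow> P p \<Longrightarrow> P q \<Longrightarrow> P (p + q)"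
    and mult: "\<And>p q. pvars p \<subseteq> E \<Longrightarrow> pvars q \<subseteq> E \<Longrightarrow> P p \<Longrightarrow> P q \<Longrightarrow> P (p * q)"
  shows "P p"
proof -
  define Q where "Q p \<longleftrightarrow> pvars p \<subseteq> E \<and> P p" for p
  have Qa: "Q (p + q)" if "Q p" "Q q" for p q
    using that add pvars_add[of p q] unfolding Q_def by blast
  have Qm: "Q (p * q)" if "Q p" "Q q" for p q
    using that mult pvars_mult[of p q] unfolding Q_def by blast
  have Qc: "Q (pconst c)" for c using const by (auto simp: Q_def)
  have Qv: "Q (pvar v)" if "v \<in> E" for v using that var by (auto simp: Q_def)
  have Qpow: "Q (pvar v ^ k)" if "v \<in> E" for v k
    by (induction k) (use that Qc[of 1] Qm Qv in auto)
  have Qmon: "Q (Poly_Mapping.single (\<Sum>v\<in>F. Poly_Mapping.single v (f v)) 1)"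
    if "finite F" "F \<subseteq> E" for F and f :: "_ \<Rightarrow> nat"
    using that
  proof (induction F)
    case empty
    then show ?case using Qc[of 1] by simp
  next
    case (insert v F)
    have "Poly_Mapping.single (\<Sum>v\<in>insert v F. Poly_Mapping.single v (f v)) (1::complex) =
        pvar v ^ f v * Poly_Mapping.single (\<Sum>v\<in>F. Poly_Mapping.single v (f v)) 1"
      using insert by (simp add: mult_single flip: single_power)
    then show ?case using insert Qm Qpow by auto
  qed
  have Qs: "Q (Poly_Mapping.single t c)" if "Poly_Mapping.keys t \<subseteq> E" for t c
  proof -
    have "Poly_Mapping.single t c = pconst c * Poly_Mapping.single t 1"
      by (simp add: pconst_def mult_single)
    moreover have "Q (Poly_Mapping.single t 1)"
      using Qmon[of "Poly_Mapping.keys t" "Poly_Mapping.lookup t"] that by (simp add: sum_single_keys)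
    ultimately show ?thesis using Qm Qc by simp
  qed
  have "Q (\<Sum>t\<in>F. Poly_Mapping.single t (g t))" if "finite F" "\<And>t. t \<in> F \<Longrightarrow> Poly_Mapping.keys t \<subseteq> E" for F g
    using that by (induction F) (use Qc[of 0] Qa Qs in auto)
  from this[of "Poly_Mapping.keys p" "Poly_Mapping.lookup p"] assms(1) have "Q p"
    by (auto simp: sum_single_keys pvars_def)
  then show ?thesis by (simp add: Q_def)
qed

section \<open>Ring homomorphisms and evaluation of polynomials\<close>

definition rhom :: "('a::comm_ring_1 \<Rightarrow> 'b::comm_ring_1) \<Rightarrow> bool" where
  "rhom h \<longleftrightarrow> (\<forall>a b. h (a + b) = h a + h b) \<and> (\<forall>a b. h (a * b) = h a * h b) \<and> h 1 = 1"

lemma rhom_add: "rhom h \<Longrightarrow> h (a + b) = h a + h b"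
  and rhom_mult: "rhom h \<Longrightarrow> h (a * b) = h a * h b"
  and rhom_1: "rhom h \<Longrightarrow> h 1 = 1"
  by (simp_all add: rhom_def)

lemma rhom_0: "rhom h \<Longrightarrow> h 0 = 0"
  using rhom_add[of h 0 0] by simp

lemma rhom_uminus: "rhom h \<Longrightarrow> h (- a) = - h a"
  using rhom_add[of h "- a" a] by (simp add: rhom_0 eq_neg_iff_add_eq_0)

lemma rhom_sum: "rhom h \<Longrightarrow> h (sum f A) = (\<Sum>a\<in>A. h (f a))"
  by (induction A rule: infinite_finite_induct) (auto simp: rhom_0 rhom_add)

lemma rhom_prod: "rhom h \<Longrightarrow> h (prod f A) = (\<Prod>a\<in>A. h (f a))"
  by (induction A rule: infinite_finite_induct) (auto simp: rhom_1 rhom_mult)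

lemma rhom_power: "rhom h \<Longrightarrow> h (a ^ k) = h a ^ k"
  by (induction k) (auto simp: rhom_1 rhom_mult)

lemma rhom_comp: "rhom g \<Longrightarrow> rhom h \<Longrightarrow> rhom (\<lambda>a. g (h a))"
  by (simp add: rhom_def)

lemma rhom_id: "rhom (\<lambda>a. a)"
  by (simp add: rhom_def)

lemma rhom_pconst: "rhom pconst"
  by (simp add: rhom_def pconst_add pconst_mult)

lemma peval_superset:
  assumes "h 0 = 0" "finite A" "Poly_Mapping.keys p \<subseteq> A"
  shows "peval h a p = (\<Sum>t\<in>A. h (Poly_Mapping.lookup p t) *
    (\<Prod>v\<in>Poly_Mapping.keys t. a v ^ Poly_Mapping.lookup t v))"
  unfolding peval_def
  by (rule sum.mono_neutral_left) (use assms in \<open>auto simp: in_keys_iff\<close>)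

lemma peval_single:
  assumes "h 0 = 0"
  shows "peval h a (Poly_Mapping.single t c) = h c * (\<Prod>v\<in>Poly_Mapping.keys t. a v ^ Poly_Mapping.lookup t v)"
  using assms by (subst peval_superset[of _ "{t}"]) auto

lemma peval_add:
  assumes "rhom h"
  shows "peval h a (p + q) = peval h a p + peval h a q"
proof -
  let ?A = "Poly_Mapping.keys p \<union> Poly_Mapping.keys q"
  show ?thesis
    using keys_add[of p q] rhom_0[OF assms]
    by (simp add: peval_superset[of h ?A] lookup_add rhom_add[OF assms] distrib_right sum.distrib)
qed

lemma peval_sum:
  assumes "rhom h"
  shows "peval h a (sum f A) = (\<Sum>i\<in>A. peval h a (f i))"
  by (induction A rule: infinite_finite_induct) (auto simp: peval_add[OF assms], auto simp: peval_def)

lemma mon_superset: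
  assumes "finite A" "Poly_Mapping.keys t \<subseteq> A"
  shows "(\<Prod>v\<in>Poly_Mapping.keys t. (a v :: 'b :: comm_ring_1) ^ Poly_Mapping.lookup t v) =
    (\<Prod>v\<in>A. a v ^ Poly_Mapping.lookup t v)"
  by (rule prod.mono_neutral_left) (use assms in \<open>auto simp: in_keys_iff\<close>)

lemma mon_add:
  "(\<Prod>v\<in>Poly_Mapping.keys (s + t). (a v :: 'b :: comm_ring_1) ^ Poly_Mapping.lookup (s + t) v) =
    (\<Prod>v\<in>Poly_Mapping.keys s. a v ^ Poly_Mapping.lookup s v) *
    (\<Prod>v\<in>Poly_Mapping.keys t. a v ^ Poly_Mapping.lookup t v)"
proof -
  let ?A = "Poly_Mapping.keys s \<union> Poly_Mapping.keys t"
  have "finite ?A" "Poly_Mapping.keys (s + t) \<subseteq> ?A" using keys_add[of s t] by auto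
  note eq = mon_superset[OF this(1), of _ a]
  show ?thesis
    unfolding eq[OF \<open>Poly_Mapping.keys (s + t) \<subseteq> ?A\<close>] eq[of s, OF Un_upper1] eq[of t, OF Un_upper2]
    by (simp add: lookup_add power_add prod.distrib)
qed

text \<open>Both factors are split into monomials, where multiplicativity is the exponent law
  \<open>mon_add\<close>.\<close>

lemma rhom_peval:
  assumes "rhom h"
  shows "rhom (peval h a)"
proof -
  have "peval h a (p * q) = peval h a p * peval h a q" for p q
  proof -
    let ?s = "\<lambda>p t. Poly_Mapping.single t (Poly_Mapping.lookup p t)"
    have "p * q = (\<Sum>s\<in>Poly_Mapping.keys p. ?s p s) * (\<Sum>t\<in>Poly_Mapping.keys q. ?s q t)"
      by (simp add: sum_single_keys)
    also have "\<dots> = (\<Sum>s\<in>Poly_Mapping.keys p. \<Sum>t\<in>Poly_Mapping.keys q. ?s p s * ?s q t)"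
      by (rule sum_product)
    finally have "peval h a (p * q) =
        (\<Sum>s\<in>Poly_Mapping.keys p. \<Sum>t\<in>Poly_Mapping.keys q. peval h a (?s p s * ?s q t))"
      by (simp add: peval_sum[OF assms])
    also have "\<dots> = (\<Sum>s\<in>Poly_Mapping.keys p. \<Sum>t\<in>Poly_Mapping.keys q.
        peval h a (?s p s) * peval h a (?s q t))"
      by (simp add: mult_single peval_single rhom_0[OF assms] rhom_mult[OF assms] mon_add mult_ac)
    also have "\<dots> = peval h a (\<Sum>s\<in>Poly_Mapping.keys p. ?s p s) * peval h a (\<Sum>t\<in>Poly_Mapping.keys q. ?s q t)"
      by (simp add: peval_sum[OF assms] sum_product)
    finally show ?thesis by (simp add: sum_single_keys)
  qed
  moreover have "peval h a 1 = 1"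
    using peval_single[of h a 0 1] by (simp add: rhom_0[OF assms] rhom_1[OF assms])
  ultimately show ?thesis by (simp add: rhom_def peval_add[OF assms])
qed

lemma peval_pconst: "rhom h \<Longrightarrow> peval h a (pconst c) = h c"
  by (simp add: pconst_def peval_single rhom_0)

lemma peval_pvar: "rhom h \<Longrightarrow> peval h a (pvar v) = a v"
  by (simp add: pvar_def peval_single rhom_0 rhom_1)

lemma rhom_cpoly_eqI:
  assumes "rhom g" "rhom h" "pvars p \<subseteq> E" "\<And>c. g (pconst c) = h (pconst c)"
    "\<And>v. v \<in> E \<Longrightarrow> g (pvar v) = h (pvar v)"
  shows "g p = h p"
  using assms(3) by (induction rule: cpoly_induct) (use assms in \<open>auto simp: rhom_add rhom_mult\<close>)

lemma rhom_poly: "rhom (\<lambda>p. poly p s)"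
  by (simp add: rhom_def)

lemma rhom_const_poly: "rhom h \<Longrightarrow> rhom (\<lambda>a. [:h a:])"
  by (simp add: rhom_def one_pCons)

lemma rpoly_eq_iff [simp]: "rpoly p = rpoly q \<longleftrightarrow> p = q"
  by (simp add: rpoly_def eq_fract)

lemma rhom_rpoly: "rhom rpoly"
  by (simp add: rhom_def rpoly_def One_fract_def)

lemma rpoly_eq_0 [simp]: "rpoly p = 0 \<longleftrightarrow> p = 0"
  using rpoly_eq_iff[of p 0] by (simp add: rhom_0[OF rhom_rpoly] del: rpoly_eq_iff)

lemma Fract_eq_rpoly: "Fract p q = rpoly p / rpoly q"
  by (simp add: rpoly_def)

lemma cst_eq: "cst c = rpoly (pconst c)"
  by (simp add: cst_def rpoly_def)

lemma rhom_cst: "rhom cst"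
  using rhom_comp[OF rhom_rpoly rhom_pconst] by (simp add: cst_eq[abs_def])

lemma rpoly_eq_peval: "rpoly p = peval cst (\<lambda>v. rpoly (pvar v)) p"
  by (rule rhom_cpoly_eqI[OF rhom_rpoly rhom_peval[OF rhom_cst], of p UNIV])
     (auto simp: peval_pconst peval_pvar rhom_cst cst_eq)

section \<open>Generated subrings and subfields, transcendental elements\<close>

inductive_set Rg :: "rfun set \<Rightarrow> rfun set" for S where
  cst: "cst c \<in> Rg S"
| gen: "s \<in> S \<Longrightarrow> s \<in> Rg S"
| add: "a \<in> Rg S \<Longrightarrow> b \<in> Rg S \<Longrightarrow> a + b \<in> Rg S"
| mult: "a \<in> Rg S \<Longrightarrow> b \<in> Rg S \<Longrightarrow> a * b \<in> Rg S"

text \<open>Since \<open>inverse 0 = 0\<close>, closing under \<open>inverse\<close> without a side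
  condition is harmless. Negation comes from multiplication by \<open>cst (-1)\<close>.\<close>

inductive_set Fd :: "rfun set \<Rightarrow> rfun set" for S where
  cst: "cst c \<in> Fd S"
| gen: "s \<in> S \<Longrightarrow> s \<in> Fd S"
| add: "a \<in> Fd S \<Longrightarrow> b \<in> Fd S \<Longrightarrow> a + b \<in> Fd S"
| mult: "a \<in> Fd S \<Longrightarrow> b \<in> Fd S \<Longrightarrow> a * b \<in> Fd S"
| inverse: "a \<in> Fd S \<Longrightarrow> inverse a \<in> Fd S"

lemma cst_0 [simp]: "cst 0 = 0" and cst_1 [simp]: "cst 1 = 1"
  by (simp_all add: rhom_0[OF rhom_cst] rhom_1[OF rhom_cst])

definition subring :: "rfun set \<Rightarrow> bool" where
  "subring A \<longleftrightarrow> (\<forall>c. cst c \<in> A) \<and> (\<forall>a\<in>A. \<forall>b\<in>A. a + b \<in> A \<and> a * b \<in> A)"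

lemma subring_Rg: "subring (Rg S)" and subring_Fd: "subring (Fd S)"
  by (auto simp: subring_def intro: Rg.intros Fd.intros)

lemma subring_cst: "subring A \<Longrightarrow> cst c \<in> A"
  and subring_add: "subring A \<Longrightarrow> a \<in> A \<Longrightarrow> b \<in> A \<Longrightarrow> a + b \<in> A"
  and subring_mult: "subring A \<Longrightarrow> a \<in> A \<Longrightarrow> b \<in> A \<Longrightarrow> a * b \<in> A"
  by (auto simp: subring_def)

lemma subring_0: "subring A \<Longrightarrow> 0 \<in> A" and subring_1: "subring A \<Longrightarrow> 1 \<in> A"
  using subring_cst[of A 0] subring_cst[of A 1] by simp_all

lemma subring_uminus: "subring A \<Longrightarrow> a \<in> A \<Longrightarrow> - a \<in> A"
  using subring_mult[of A "cst (-1)" a] subring_cst[of A "-1"]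
  by (simp add: rhom_uminus[OF rhom_cst])

lemma subring_diff: "subring A \<Longrightarrow> a \<in> A \<Longrightarrow> b \<in> A \<Longrightarrow> a - b \<in> A"
  using subring_add[of A a "- b"] subring_uminus[of A b] by simp

lemma subring_power: "subring A \<Longrightarrow> a \<in> A \<Longrightarrow> a ^ k \<in> A"
  by (induction k) (auto intro: subring_1 subring_mult)

lemma subring_sum: "subring A \<Longrightarrow> (\<And>i. i \<in> I \<Longrightarrow> f i \<in> A) \<Longrightarrow> sum f I \<in> A"
  by (induction I rule: infinite_finite_induct) (auto intro: subring_0 subring_add)

lemma subring_prod: "subring A \<Longrightarrow> (\<And>i. i \<in> I \<Longrightarrow> f i \<in> A) \<Longrightarrow> prod f I \<in> A"
  by (induction I rule: infinite_finite_induct) (auto intro: subring_1 subring_mult)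

lemmas subring_intros = subring_cst subring_0 subring_1 subring_add subring_mult
  subring_uminus subring_diff subring_power subring_sum subring_prod

lemmas Fd_intros = subring_intros[OF subring_Fd]
lemmas Rg_intros = subring_intros[OF subring_Rg]

lemma Fd_divide: "a \<in> Fd S \<Longrightarrow> b \<in> Fd S \<Longrightarrow> a / b \<in> Fd S"
  by (simp add: divide_inverse Fd.intros)

lemma Rg_least: "subring A \<Longrightarrow> S \<subseteq> A \<Longrightarrow> Rg S \<subseteq> A"
proof
  fix x assume "subring A" "S \<subseteq> A" "x \<in> Rg S"
  from this(3) show "x \<in> A"
    by induction (use \<open>subring A\<close> \<open>S \<subseteq> A\<close> in \<open>auto intro: subring_intros\<close>)
qed

lemma Rg_subset_Fd: "Rg S \<subseteq> Fd S"
  by (rule Rg_least) (auto intro: subring_Fd Fd.gen)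

lemma Rg_mono: "S \<subseteq> Rg T \<Longrightarrow> Rg S \<subseteq> Rg T"
  by (rule Rg_least) (auto intro: subring_Rg)

lemma Fd_mono: "S \<subseteq> Fd T \<Longrightarrow> Fd S \<subseteq> Fd T"
proof
  fix x assume "S \<subseteq> Fd T" "x \<in> Fd S"
  from this(2) show "x \<in> Fd T"
    by induction (use \<open>S \<subseteq> Fd T\<close> in \<open>auto intro: Fd.intros\<close>)
qed

lemma peval_cst_mem:
  assumes "subring A" "pvars p \<subseteq> E" "\<And>v. v \<in> E \<Longrightarrow> g v \<in> A"
  shows "peval cst g p \<in> A"
  using assms(2) by (induction rule: cpoly_induct)
    (use assms in \<open>auto simp: peval_pconst peval_pvar rhom_cst rhom_add[OF rhom_peval] rhom_mult[OF rhom_peval]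
       intro: subring_intros\<close>)

lemma gen_ring_eq_Rg: "gen_ring g E = Rg (g ` E)"
proof
  show "gen_ring g E \<subseteq> Rg (g ` E)"
    by (auto simp: gen_ring_def intro!: peval_cst_mem[OF subring_Rg] intro: Rg.gen)
  note h = rhom_peval[OF rhom_cst]
  have "x \<in> gen_ring g E" if "x \<in> Rg (g ` E)" for x
    using that
  proof induction
    case (cst c)
    then show ?case unfolding gen_ring_def
      by (auto intro!: exI[of _ "pconst c"] simp: peval_pconst rhom_cst)
  next
    case (gen s)
    then obtain e where "e \<in> E" "s = g e" by auto
    then show ?case unfolding gen_ring_def
      by (auto intro!: exI[of _ "pvar e"] simp: peval_pvar rhom_cst)
  next
    case (add a b)
    then obtain p q where pq: "a = peval cst g p" "b = peval cst g q" "pvars p \<subseteq> E" "pvars q \<subseteq> E"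
      by (auto simp: gen_ring_def)
    with pvars_add[of p q] show ?case unfolding gen_ring_def
      by (auto intro!: exI[of _ "p + q"] simp: rhom_add[OF h])
  next
    case (mult a b)
    then obtain p q where pq: "a = peval cst g p" "b = peval cst g q" "pvars p \<subseteq> E" "pvars q \<subseteq> E"
      by (auto simp: gen_ring_def)
    with pvars_mult[of p q] show ?case unfolding gen_ring_def
      by (auto intro!: exI[of _ "p * q"] simp: rhom_mult[OF h])
  qed
  then show "Rg (g ` E) \<subseteq> gen_ring g E" by blast
qed

lemma Fd_eq_quotients: "Fd S = {a / b | a b. a \<in> Rg S \<and> b \<in> Rg S \<and> b \<noteq> 0}" (is "_ = ?Q")
proof
  have QI: "x \<in> ?Q" if "x = a / b" "a \<in> Rg S" "b \<in> Rg S" "b \<noteq> 0" for x a b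
    using that by blast
  have "x \<in> ?Q" if "x \<in> Fd S" for x
    using that
  proof induction
    case (cst c)
    show ?case by (rule QI[of _ "cst c" 1]) (auto intro: Rg.intros Rg_intros)
  next
    case (gen s)
    then show ?case by (intro QI[of _ s 1]) (auto intro: Rg.intros Rg_intros)
  next
    case (add x y)
    then obtain a b c d where *: "x = a / b" "y = c / d" "a \<in> Rg S" "b \<in> Rg S" "c \<in> Rg S" "d \<in> Rg S"
      "b \<noteq> 0" "d \<noteq> 0" by blast
    show ?case by (rule QI[of _ "a * d + c * b" "b * d"])
      (use * in \<open>auto simp: add_frac_eq intro!: Rg.add Rg.mult\<close>)
  next
    case (mult x y)
    then obtain a b c d where *: "x = a / b" "y = c / d" "a \<in> Rg S" "b \<in> Rg S" "c \<in> Rg S" "d \<in> Rg S"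
      "b \<noteq> 0" "d \<noteq> 0" by blast
    show ?case by (rule QI[of _ "a * c" "b * d"]) (use * in \<open>auto intro!: Rg.mult\<close>)
  next
    case (inverse x)
    then obtain a b where *: "x = a / b" "a \<in> Rg S" "b \<in> Rg S" "b \<noteq> 0" by blast
    show ?case
    proof (cases "a = 0")
      case True
      then show ?thesis by (intro QI[of _ 0 1]) (auto simp: * intro: Rg_intros)
    next
      case False
      with * show ?thesis by (intro QI[of _ b a]) auto
    qed
  qed
  then show "Fd S \<subseteq> ?Q" by blast
  show "?Q \<subseteq> Fd S"
    using Rg_subset_Fd by (auto intro!: Fd_divide)
qed

lemma gen_field_eq_Fd: "gen_field g E = Fd (g ` E)"
  unfolding Fd_eq_quotients gen_ring_eq_Rg[symmetric] gen_field_def gen_ring_def by blast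

lemma PolR_eq: "PolR m n = Rg ((\<lambda>v. rpoly (pvar v)) ` Xvars m n)"
proof -
  define a where "a = (\<lambda>v :: var. rpoly (pvar v))"
  have eq: "rpoly p = peval cst a p" for p
    using rpoly_eq_peval[of p] by (simp add: a_def)
  have "PolR m n = gen_ring a (Xvars m n)"
    by (auto simp: PolR_def gen_ring_def eq)
  then show ?thesis by (simp add: gen_ring_eq_Rg a_def)
qed

lemma RatF_eq: "RatF m n = Fd ((\<lambda>v. rpoly (pvar v)) ` Xvars m n)"
proof -
  have "RatF m n = {a / b | a b. a \<in> PolR m n \<and> b \<in> PolR m n \<and> b \<noteq> 0}" (is "_ = ?Q")
  proof (rule set_eqI, rule iffI)
    fix f assume "f \<in> RatF m n"
    then obtain p q where *: "f = Fract p q" "q \<noteq> 0" "pvars p \<subseteq> Xvars m n" "pvars q \<subseteq> Xvars m n"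
      by (auto simp: RatF_def)
    have "f = rpoly p / rpoly q" "rpoly p \<in> PolR m n" "rpoly q \<in> PolR m n" "rpoly q \<noteq> 0"
      using * by (auto simp: PolR_def Fract_eq_rpoly)
    then show "f \<in> ?Q" by blast
  next
    fix f assume "f \<in> ?Q"
    then obtain p q where "f = rpoly p / rpoly q" "pvars p \<subseteq> Xvars m n" "pvars q \<subseteq> Xvars m n" "rpoly q \<noteq> 0"
      by (auto simp: PolR_def)
    then show "f \<in> RatF m n" unfolding RatF_def by (auto simp flip: Fract_eq_rpoly)
  qed
  then show ?thesis by (simp add: Fd_eq_quotients PolR_eq)
qed

section \<open>Univariate polynomials with coefficients in a subring\<close>

definition Pol :: "rfun set \<Rightarrow> rfun poly set" where
  "Pol A = {p. \<forall>i. coeff p i \<in> A}"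

lemma Pol_coeff: "p \<in> Pol A \<Longrightarrow> coeff p i \<in> A"
  by (simp add: Pol_def)

lemma Pol_mono: "A \<subseteq> B \<Longrightarrow> p \<in> Pol A \<Longrightarrow> p \<in> Pol B"
  by (auto simp: Pol_def)

lemma Pol_pCons: "pCons a p \<in> Pol A \<longleftrightarrow> a \<in> A \<and> p \<in> Pol A"
  unfolding Pol_def by (simp add: coeff_pCons split: nat.split) (metis nat.exhaust)

lemma Pol_0: "subring A \<Longrightarrow> 0 \<in> Pol A" and Pol_1: "subring A \<Longrightarrow> 1 \<in> Pol A"
  by (auto simp: Pol_def coeff_1 intro: subring_intros)

lemma Pol_add: "subring A \<Longrightarrow> p \<in> Pol A \<Longrightarrow> q \<in> Pol A \<Longrightarrow> p + q \<in> Pol A"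
  and Pol_diff: "subring A \<Longrightarrow> p \<in> Pol A \<Longrightarrow> q \<in> Pol A \<Longrightarrow> p - q \<in> Pol A"
  and Pol_smult: "subring A \<Longrightarrow> a \<in> A \<Longrightarrow> p \<in> Pol A \<Longrightarrow> smult a p \<in> Pol A"
  by (auto simp: Pol_def intro: subring_intros)

lemma Pol_mult: "subring A \<Longrightarrow> p \<in> Pol A \<Longrightarrow> q \<in> Pol A \<Longrightarrow> p * q \<in> Pol A"
  by (auto simp: Pol_def coeff_mult intro!: subring_intros)

lemma Pol_monom: "subring A \<Longrightarrow> a \<in> A \<Longrightarrow> monom a k \<in> Pol A"
  by (auto simp: Pol_def intro: subring_0)

lemma Pol_power: "subring A \<Longrightarrow> p \<in> Pol A \<Longrightarrow> p ^ k \<in> Pol A"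
  by (induction k) (auto intro: Pol_1 Pol_mult)

lemma Pol_pcompose: "subring A \<Longrightarrow> p \<in> Pol A \<Longrightarrow> q \<in> Pol A \<Longrightarrow> pcompose p q \<in> Pol A"
proof (induction p)
  case (pCons a p)
  then show ?case by (auto simp: pcompose_pCons Pol_pCons intro!: Pol_add Pol_mult Pol_0)
qed (auto intro: Pol_0)

lemma Pol_poly: "subring A \<Longrightarrow> p \<in> Pol A \<Longrightarrow> s \<in> A \<Longrightarrow> poly p s \<in> A"
  by (induction p) (auto simp: Pol_pCons intro: subring_intros)

lemma Pol_synthetic_div: "subring A \<Longrightarrow> p \<in> Pol A \<Longrightarrow> s \<in> A \<Longrightarrow> synthetic_div p s \<in> Pol A"
  by (induction p) (auto simp: Pol_pCons intro: Pol_0 Pol_poly)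

lemma Rg_insert: "Rg (insert s S) = {poly p s | p. p \<in> Pol (Rg S)}"
proof
  have "x \<in> {poly p s | p. p \<in> Pol (Rg S)}" if "x \<in> Rg (insert s S)" for x
    using that
  proof induction
    case (cst c)
    have "cst c = poly [:cst c:] s" "[:cst c:] \<in> Pol (Rg S)"
      by (auto simp: Pol_pCons intro: Rg.intros Pol_0 subring_Rg)
    then show ?case by blast
  next
    case (gen t)
    have "s = poly [:0,1:] s" "[:0,1:] \<in> Pol (Rg S)"
      by (auto simp: Pol_pCons intro: Rg_intros Pol_0 subring_Rg)
    moreover have "t = poly [:t:] s" by simp
    moreover have "[:t:] \<in> Pol (Rg S)" if "t \<in> S"
      using that by (auto simp: Pol_pCons intro: Rg.intros Pol_0 subring_Rg)
    ultimately show ?case using gen by blast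
  next
    case (add a b)
    then obtain p q where *: "a = poly p s" "b = poly q s" "p \<in> Pol (Rg S)" "q \<in> Pol (Rg S)" by blast
    then show ?case using Pol_add[OF subring_Rg *(3,4)] by (auto intro!: exI[of _ "p + q"])
  next
    case (mult a b)
    then obtain p q where *: "a = poly p s" "b = poly q s" "p \<in> Pol (Rg S)" "q \<in> Pol (Rg S)" by blast
    then show ?case using Pol_mult[OF subring_Rg *(3,4)] by (auto intro!: exI[of _ "p * q"])
  qed
  then show "Rg (insert s S) \<subseteq> {poly p s | p. p \<in> Pol (Rg S)}" by blast
  have "Rg S \<subseteq> Rg (insert s S)" by (rule Rg_mono) (auto intro: Rg.gen)
  then show "{poly p s | p. p \<in> Pol (Rg S)} \<subseteq> Rg (insert s S)"
    using Pol_mono[of "Rg S"] by (auto intro!: Pol_poly[OF subring_Rg] intro: Rg.gen)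
qed

lemma Fd_insert:
  assumes "f \<in> Fd (insert s S)"
  obtains p q where "p \<in> Pol (Fd S)" "q \<in> Pol (Fd S)" "poly q s \<noteq> 0" "f = poly p s / poly q s"
proof -
  from assms obtain a b where ab: "f = a / b" "a \<in> Rg (insert s S)" "b \<in> Rg (insert s S)" "b \<noteq> 0"
    by (auto simp: Fd_eq_quotients)
  then obtain p q where "p \<in> Pol (Rg S)" "q \<in> Pol (Rg S)" "a = poly p s" "b = poly q s"
    by (auto simp: Rg_insert)
  then show ?thesis using ab that[of p q] Pol_mono[OF Rg_subset_Fd] by blast
qed

section \<open>Transcendence of one element over a subfield\<close>

definition Transc :: "rfun \<Rightarrow> rfun set \<Rightarrow> bool" where
  "Transc s k \<longleftrightarrow> (\<forall>p\<in>Pol k. poly p s = 0 \<longrightarrow> p = 0)"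

lemma TranscD: "Transc s k \<Longrightarrow> p \<in> Pol k \<Longrightarrow> poly p s = 0 \<Longrightarrow> p = 0"
  by (simp add: Transc_def)

lemma Transc_eq: "Transc s k \<Longrightarrow> subring k \<Longrightarrow> p \<in> Pol k \<Longrightarrow> q \<in> Pol k \<Longrightarrow> poly p s = poly q s \<Longrightarrow> p = q"
  using TranscD[of s k "p - q"] by (simp add: Pol_diff)

lemma Transc_mono: "Transc s K \<Longrightarrow> k \<subseteq> K \<Longrightarrow> Transc s k"
  using Pol_mono unfolding Transc_def by blast

lemma Transc_notin: "Transc s k \<Longrightarrow> subring k \<Longrightarrow> s \<notin> k"
  using TranscD[of s k "[:-s, 1:]"] by (auto simp: Pol_pCons intro: subring_intros Pol_0)

lemma Transc_affine:
  assumes "Transc s (Fd S)" "a \<in> Fd S" "b \<in> Fd S" "a \<noteq> 0"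
  shows "Transc (a * s + b) (Fd S)"
  unfolding Transc_def
proof (intro ballI impI)
  fix p assume p: "p \<in> Pol (Fd S)" "poly p (a * s + b) = 0"
  then have "poly (pcompose p [:b, a:]) s = 0" by (simp add: poly_pcompose add.commute mult.commute)
  moreover have "pcompose p [:b, a:] \<in> Pol (Fd S)"
    using p(1) assms by (auto simp: Pol_pCons intro!: Pol_pcompose[OF subring_Fd] Pol_0[OF subring_Fd])
  ultimately have "pcompose p [:b, a:] = 0" using TranscD[OF assms(1)] by blast
  then show "p = 0" using assms(4) by (simp add: pcompose_eq_0_iff)
qed

text \<open>A relation for \<open>inverse s\<close> becomes one for \<open>s\<close> by reversing
  the order of its coefficients.\<close>

lemma Transc_inverse:
  assumes "Transc s (Fd S)"
  shows "Transc (inverse s) (Fd S)"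
  unfolding Transc_def
proof (intro ballI impI)
  fix p assume p: "p \<in> Pol (Fd S)" "poly p (inverse s) = 0"
  have "s \<noteq> 0" using Transc_notin[OF assms subring_Fd] Fd_intros(2) by blast
  then have "poly (reflect_poly p) s = 0"
    using poly_reflect_poly_nz[of s p] p by simp
  moreover have "reflect_poly p \<in> Pol (Fd S)"
    using p(1) by (auto simp: Pol_def coeff_reflect_poly intro: Fd_intros)
  ultimately have "reflect_poly p = 0" using TranscD[OF assms] by blast
  then show "p = 0" by simp
qed

text \<open>A Moebius map is composed of affine maps and an inversion. For c \<noteq> 0 the scale
  factor after the inversion is -(ad - bc)/c, which the determinant keeps nonzero.\<close>

lemma Transc_moebius:
  assumes s: "Transc s (Fd S)" and k: "a \<in> Fd S" "b \<in> Fd S" "c \<in> Fd S" "d \<in> Fd S"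
    and "a * d - b * c \<noteq> 0"
  shows "Transc ((a * s + b) / (c * s + d)) (Fd S)"
proof (cases "c = 0")
  case True
  then have "(a * s + b) / (c * s + d) = a / d * s + b / d" "d \<noteq> 0" "a \<noteq> 0"
    using assms(6) by (auto simp: add_divide_distrib)
  then show ?thesis using Transc_affine[OF s, of "a / d" "b / d"] k by (simp add: Fd_divide)
next
  case False
  have t: "Transc (c * s + d) (Fd S)" by (rule Transc_affine) (use assms False in auto)
  then have nz: "c * s + d \<noteq> 0" using Transc_notin[OF t subring_Fd] Fd_intros(2) by metis
  have "(a * s + b) / (c * s + d) = (b - a * d / c) * inverse (c * s + d) + a / c"
  proof -
    have "a * s + b = (b - a * d / c) + a / c * (c * s + d)"
      using False by (simp add: field_simps)
    then show ?thesis using nz by (simp only: add_divide_distrib) (simp add: divide_inverse)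
  qed
  moreover have "Transc \<dots> (Fd S)"
  proof (rule Transc_affine[OF Transc_inverse[OF t]])
    show "b - a * d / c \<noteq> 0" using False assms(6) by (simp add: field_simps)
  qed (use k in \<open>auto intro!: Fd_intros Fd_divide\<close>)
  ultimately show ?thesis by simp
qed

text \<open>If s is transcendental over K, then the intersection of k(s) and K[s] is k[s].\<close>
lemma Fd_insert_poly:
  assumes "Transc s K" "subring K" "Fd S \<subseteq> K" "h \<in> Pol K" "poly h s \<in> Fd (insert s S)"
  shows "h \<in> Pol (Fd S)"
proof -
  obtain p q where pq: "p \<in> Pol (Fd S)" "q \<in> Pol (Fd S)" "poly q s \<noteq> 0" "poly h s = poly p s / poly q s"
    using Fd_insert[OF assms(5)] .
  have *: "q * h = p"
    using pq assms by (intro Transc_eq[OF assms(1,2)])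
      (auto intro: Pol_mult Pol_mono[OF assms(3)])
  have q0: "q \<noteq> 0" using pq(3) by auto
  \<comment> \<open>Now q h = p with p and q over the small field, so the leading coefficient of h
    is a quotient of theirs. Removing the leading term of h replaces p by p minus q times that term,
    and induction on the degree applies.\<close>
  from * pq(1) show ?thesis
  proof (induction "degree h" arbitrary: h p rule: less_induct)
    case less
    show ?case
    proof (cases "h = 0")
      case False
      let ?l = "lead_coeff h" and ?m = "monom (lead_coeff h) (degree h)"
      have "?l = lead_coeff p / lead_coeff q"
        using less(2) q0 by (auto simp: lead_coeff_mult simp flip: less(2))
      then have l: "?l \<in> Fd S" using less(3) pq(2) by (auto intro!: Fd_divide Pol_coeff)
      have m: "?m \<in> Pol (Fd S)" by (intro Pol_monom subring_Fd l)
      have "h - ?m \<in> Pol (Fd S)"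
      proof (cases "h - ?m = 0")
        case True then show ?thesis by (simp add: Pol_0 subring_Fd)
      next
        case nz: False
        have "degree (h - ?m) < degree h"
        proof (rule ccontr)
          assume "\<not> ?thesis"
          moreover have "degree (h - ?m) \<le> degree h"
            by (intro degree_diff_le degree_monom_le) auto
          ultimately have "degree (h - ?m) = degree h" by simp
          then have "coeff (h - ?m) (degree (h - ?m)) = 0" by (metis coeff_diff coeff_monom diff_self)
          with nz show False by (simp only: leading_coeff_0_iff)
        qed
        then show ?thesis
          by (rule less(1)[of _ "p - q * ?m"])
            (use less(2,3) in \<open>simp_all add: right_diff_distrib Pol_diff Pol_mult subring_Fd pq(2) m\<close>)
      qed
      then show ?thesis using Pol_add[OF subring_Fd _ m, of "h - ?m"] by simp
    qed (auto intro: Pol_0 subring_Fd)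
  qed
qed

text \<open>The form used for the descent along the tower: over K the element f is a constant
  polynomial in s, and its only coefficient must already lie in \<open>Fd S\<close>.\<close>

lemma Fd_insert_const:
  assumes "Transc s K" "subring K" "Fd S \<subseteq> K" "f \<in> K" "f \<in> Fd (insert s S)"
  shows "f \<in> Fd S"
  using Fd_insert_poly[OF assms(1-3), of "[:f:]"] assms by (simp add: Pol_pCons Pol_0)

section \<open>Algebraic independence of families\<close>

lemma rhom_map_poly:
  assumes "rhom h"
  shows "rhom (map_poly h)"
  using rhom_0[OF assms]
  by (auto simp: rhom_def rhom_1[OF assms] coeff_map_poly coeff_mult rhom_add[OF assms] rhom_sum[OF assms]
      rhom_mult[OF assms] intro!: poly_eqI)

text \<open>A polynomial regrouped by powers of the variable \<open>e\<close>. The coefficients keep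
  the full variable type; that \<open>e\<close> is gone from them is recorded by
  \<open>pvars_coeff_upoly\<close>.\<close>

definition upoly :: "'v \<Rightarrow> 'v cpoly \<Rightarrow> 'v cpoly poly" where
  "upoly e = peval (\<lambda>c. [:pconst c:]) (\<lambda>v. if v = e then [:0, 1:] else [:pvar v:])"

lemma rhom_upoly: "rhom (upoly e)"
  unfolding upoly_def by (intro rhom_peval rhom_const_poly rhom_pconst)

lemma upoly_pconst: "upoly e (pconst c) = [:pconst c:]"
  and upoly_pvar: "upoly e (pvar v) = (if v = e then [:0, 1:] else [:pvar v:])"
  unfolding upoly_def by (simp_all add: peval_pconst peval_pvar rhom_const_poly rhom_pconst)

lemma upoly_const: "pvars p \<subseteq> E \<Longrightarrow> e \<notin> E \<Longrightarrow> upoly e p = [:p:]"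
  by (rule rhom_cpoly_eqI[OF rhom_upoly rhom_const_poly])
    (auto simp: upoly_pconst upoly_pvar rhom_def)

lemma poly_upoly: "poly (upoly e p) (pvar e) = p"
  by (rule rhom_cpoly_eqI[OF rhom_comp[OF rhom_poly rhom_upoly] rhom_id, of _ UNIV])
    (simp_all add: upoly_pconst upoly_pvar)

lemma pvars_coeff_upoly: "pvars p \<subseteq> insert e E \<Longrightarrow> e \<notin> E \<Longrightarrow> pvars (coeff (upoly e p) i) \<subseteq> E"
proof (induction arbitrary: i rule: cpoly_induct)
  case (const c)
  then show ?case by (cases i) (auto simp: upoly_pconst)
next
  case (var v)
  then show ?case by (auto simp: upoly_pvar coeff_pCons split: nat.splits)
next
  case (add p q)
  then show ?case using pvars_add[of "coeff (upoly e p) i" "coeff (upoly e q) i"]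
    by (fastforce simp: rhom_add[OF rhom_upoly])
next
  case (mult p q)
  show ?case unfolding rhom_mult[OF rhom_upoly] coeff_mult
  proof (rule pvars_sum)
    fix j
    show "pvars (coeff (upoly e p) j * coeff (upoly e q) (i - j)) \<subseteq> E"
      using pvars_mult[of "coeff (upoly e p) j" "coeff (upoly e q) (i - j)"] mult by blast
  qed
qed

lemma peval_upoly: "peval cst g p = poly (map_poly (peval cst g) (upoly e p)) (g e)"
proof -
  note h = rhom_peval[OF rhom_cst, of g]
  have "rhom (\<lambda>p. map_poly (peval cst g) (upoly e p))"
    by (rule rhom_comp[OF rhom_map_poly[OF h] rhom_upoly])
  then have "rhom (\<lambda>p. poly (map_poly (peval cst g) (upoly e p)) (g e))"
    by (rule rhom_comp[OF rhom_poly])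
  then show ?thesis
    by (rule rhom_cpoly_eqI[OF h, of _ _ UNIV])
      (simp_all add: upoly_pconst upoly_pvar map_poly_pCons peval_pconst peval_pvar rhom_cst
        rhom_0[OF h] rhom_1[OF h])
qed

text \<open>Turns relations over the generated field into relations over the generated ring, whose
  elements are values of polynomials in the generators.\<close>

lemma clear_denominators:
  "p \<in> Pol (Fd S) \<Longrightarrow> \<exists>d\<in>Rg S. d \<noteq> 0 \<and> smult d p \<in> Pol (Rg S)"
proof (induction p)
  case 0
  show ?case by (rule bexI[of _ 1]) (auto intro: Rg_intros Pol_0 subring_Rg)
next
  case (pCons a p)
  then obtain d where d: "d \<in> Rg S" "d \<noteq> 0" "smult d p \<in> Pol (Rg S)" by (auto simp: Pol_pCons)
  from pCons obtain x y where xy: "a = x / y" "x \<in> Rg S" "y \<in> Rg S" "y \<noteq> 0"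
    by (auto simp: Pol_pCons Fd_eq_quotients)
  have "smult (y * d) (pCons a p) = pCons (d * x) (smult y (smult d p))"
    using xy by simp
  also have "\<dots> \<in> Pol (Rg S)"
    using xy d by (auto simp: Pol_pCons simp del: smult_smult intro: Rg.mult Pol_smult subring_Rg)
  finally show ?case using xy d by (intro bexI[of _ "y * d"]) (auto intro: Rg.mult)
qed

lemma alg_indep_mono: "alg_indep g E \<Longrightarrow> F \<subseteq> E \<Longrightarrow> alg_indep g F"
  unfolding alg_indep_def by blast

lemma alg_indep_cong: "(\<And>e. e \<in> E \<Longrightarrow> g e = h e) \<Longrightarrow> alg_indep g E = alg_indep h E"
proof -
  assume *: "\<And>e. e \<in> E \<Longrightarrow> g e = h e"
  have "peval cst g P = peval cst h P" if "pvars P \<subseteq> E" for P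
    by (rule rhom_cpoly_eqI[OF rhom_peval rhom_peval that])
      (auto simp: peval_pconst peval_pvar rhom_cst *)
  then show ?thesis unfolding alg_indep_def by metis
qed

lemma alg_indep_empty: "alg_indep g {}"
  unfolding alg_indep_def
proof (intro allI impI)
  fix P assume P: "pvars P \<subseteq> {}" "peval cst g P = 0"
  from P(1) have "\<exists>c. P = pconst c"
    by (induction rule: cpoly_induct) (auto simp flip: pconst_add pconst_mult)
  then obtain c where c: "P = pconst c" by blast
  then have "cst c = cst 0" using P(2) by (simp add: peval_pconst rhom_cst)
  then have "pconst c = (pconst 0 :: var cpoly)" by (simp only: cst_eq rpoly_eq_iff)
  then have "c = 0" unfolding pconst_def by (metis lookup_single_eq)
  then show "P = 0" using c by simp
qed

text \<open>A relation is regrouped by powers of the variable \<open>e\<close>: transcendence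
  annihilates the value of each coefficient, and independence of \<open>E\<close> then annihilates
  the coefficient itself.\<close>

lemma alg_indep_insertI:
  assumes "alg_indep g E" "e \<notin> E" "Transc (g e) (Fd (g ` E))"
  shows "alg_indep g (insert e E)"
  unfolding alg_indep_def
proof (intro allI impI)
  fix P assume P: "pvars P \<subseteq> insert e E" "peval cst g P = 0"
  note [simp] = rhom_0[OF rhom_peval[OF rhom_cst, of g]]
  have c: "pvars (coeff (upoly e P) i) \<subseteq> E" for i
    using pvars_coeff_upoly[OF P(1) assms(2)] .
  have "map_poly (peval cst g) (upoly e P) \<in> Pol (Fd (g ` E))"
    using c by (auto simp: Pol_def coeff_map_poly intro!: peval_cst_mem[OF subring_Fd] intro: Fd.gen)
  then have "map_poly (peval cst g) (upoly e P) = 0"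
    using TranscD[OF assms(3)] P(2) by (simp add: peval_upoly[of g P e])
  then have "peval cst g (coeff (upoly e P) i) = 0" for i
    by (metis coeff_0 coeff_map_poly rhom_0[OF rhom_peval[OF rhom_cst]])
  then have "upoly e P = 0"
    using assms(1) c unfolding alg_indep_def by (intro poly_eqI) auto
  then show "P = 0" using poly_upoly[of e P] by simp
qed

text \<open>A relation for \<open>g e\<close> is cleared of denominators and its coefficients are
  lifted to polynomials \<open>R i\<close> in the variables of \<open>E\<close>. Reassembled with
  powers of the variable \<open>e\<close>, they form a relation that independence forces to be
  trivial.\<close>

lemma alg_indep_insertD:
  assumes "alg_indep g (insert e E)" "e \<notin> E"
  shows "Transc (g e) (Fd (g ` E))"
  unfolding Transc_def
proof (intro ballI impI)
  fix p assume p: "p \<in> Pol (Fd (g ` E))" "poly p (g e) = 0"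
  note h = rhom_peval[OF rhom_cst, of g]
  obtain d where d: "d \<noteq> 0" "smult d p \<in> Pol (Rg (g ` E))"
    using clear_denominators[OF p(1)] by blast
  define q where "q = smult d p"
  have "\<exists>R. pvars R \<subseteq> E \<and> coeff q i = peval cst g R" for i
    using Pol_coeff[OF d(2), of i] by (auto simp: q_def gen_ring_def simp flip: gen_ring_eq_Rg)
  then obtain R where R: "\<And>i. pvars (R i) \<subseteq> E" "\<And>i. coeff q i = peval cst g (R i)" by metis
  define P where "P = (\<Sum>i\<le>degree q. R i * pvar e ^ i)"
  have "pvars (pvar e ^ i) \<subseteq> insert e E" for i
    using pvars_prod[of "{..<i}" "\<lambda>_. pvar e" "insert e E"] by simp
  then have "pvars P \<subseteq> insert e E"
    unfolding P_def
  proof (intro pvars_sum)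
    fix i
    show "pvars (R i * pvar e ^ i) \<subseteq> insert e E"
      using pvars_mult[of "R i" "pvar e ^ i"] R(1)[of i] \<open>pvars (pvar e ^ i) \<subseteq> insert e E\<close> by blast
  qed
  moreover have "peval cst g P = 0"
  proof -
    have "peval cst g P = (\<Sum>i\<le>degree q. coeff q i * g e ^ i)"
      by (simp add: P_def rhom_sum[OF h] rhom_mult[OF h] rhom_power[OF h] peval_pvar rhom_cst R(2))
    also have "\<dots> = poly q (g e)" by (rule poly_altdef[symmetric])
    also have "\<dots> = 0" using p(2) by (simp add: q_def)
    finally show ?thesis .
  qed
  ultimately have "P = 0" using assms(1) by (auto simp: alg_indep_def)
  then have "upoly e P = 0" by (simp add: rhom_0[OF rhom_upoly])
  moreover have "upoly e P = (\<Sum>i\<le>degree q. monom (R i) i)"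
    by (auto simp: P_def rhom_sum[OF rhom_upoly] rhom_mult[OF rhom_upoly] rhom_power[OF rhom_upoly]
        upoly_pvar upoly_const[OF R(1) assms(2)] monom_altdef intro!: sum.cong)
  ultimately have "coeff (\<Sum>i\<le>degree q. monom (R i) i) (degree q) = 0" by simp
  then have "R (degree q) = 0" by (simp add: coeff_sum)
  then have "lead_coeff q = 0" by (simp add: R(2) rhom_0[OF h])
  then have "q = 0" by simp
  then show "p = 0" using d by (simp add: q_def)
qed

lemma alg_indep_iff_Transc:
  assumes "finite E"
  shows "alg_indep g E \<longleftrightarrow> (\<forall>e\<in>E. Transc (g e) (Fd (g ` (E - {e}))))"
proof
  assume *: "alg_indep g E"
  show "\<forall>e\<in>E. Transc (g e) (Fd (g ` (E - {e})))"
    using * by (auto intro!: alg_indep_insertD simp: insert_absorb)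
next
  assume *: "\<forall>e\<in>E. Transc (g e) (Fd (g ` (E - {e})))"
  have "alg_indep g F" if "finite F" "F \<subseteq> E" for F
    using that
  proof (induction F)
    case (insert e F)
    have "Fd (g ` F) \<subseteq> Fd (g ` (E - {e}))"
      using insert by (intro Fd_mono) (auto intro: Fd.gen)
    then show ?case using insert * by (auto intro!: alg_indep_insertI elim: Transc_mono)
  qed (rule alg_indep_empty)
  then show "alg_indep g E" using assms by blast
qed

text \<open>\<open>alg_indep\<close> speaks of polynomials whose variables are the indices, so a
  change of index type goes through the criterion by transcendence, which only mentions
  values.\<close>

lemma alg_indep_reindex:
  assumes "alg_indep g (f ` E)" "inj_on f E" "finite E"
  shows "alg_indep (\<lambda>e. g (f e)) E"
  unfolding alg_indep_iff_Transc[OF assms(3)]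
proof
  fix e assume e: "e \<in> E"
  then have "(\<lambda>e. g (f e)) ` (E - {e}) = g ` (f ` E - {f e})"
    using assms(2) by (auto simp: inj_on_def)
  then show "Transc (g (f e)) (Fd ((\<lambda>e. g (f e)) ` (E - {e})))"
    using assms e alg_indep_iff_Transc[of "f ` E" g] by auto
qed

text \<open>In order of increasing rank, each \<open>h e\<close> is affine in \<open>x e\<close>
  with coefficients from smaller ranks. Hence it is transcendental over the field of the earlier
  \<open>x d\<close>, and that field contains the earlier \<open>h d\<close>.\<close>

lemma alg_indep_triangular:
  fixes rank :: "'i \<Rightarrow> nat"
  assumes "finite E" "inj_on rank E" "alg_indep x E"
    and tri: "\<And>e. e \<in> E \<Longrightarrow> \<exists>s r. s \<in> Fd (x ` {d\<in>E. rank d < rank e}) \<and>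
      r \<in> Fd (x ` {d\<in>E. rank d < rank e}) \<and> s \<noteq> 0 \<and> h e = s * x e + r"
  shows "alg_indep h E"
proof -
  have sub: "h e \<in> Fd (x ` {d\<in>E. rank d < k})" if e: "e \<in> E" "rank e < k" for e k
  proof -
    have "Fd (x ` {d\<in>E. rank d < rank e}) \<subseteq> Fd (x ` {d\<in>E. rank d < k})"
      using that by (intro Fd_mono) (auto intro: Fd.gen)
    moreover have "x e \<in> Fd (x ` {d\<in>E. rank d < k})"
      using that by (auto intro: Fd.gen)
    moreover obtain s r where "s \<in> Fd (x ` {d\<in>E. rank d < rank e})"
      "r \<in> Fd (x ` {d\<in>E. rank d < rank e})" and h: "h e = s * x e + r"
      using tri[OF e(1)] by blast
    ultimately show ?thesis unfolding h by (blast intro: Fd.add Fd.mult)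
  qed
  have "alg_indep h {e\<in>E. rank e < k}" for k
  proof (induction k)
    case 0
    show ?case by (simp add: alg_indep_empty)
  next
    case (Suc k)
    show ?case
    proof (cases "\<exists>e\<in>E. rank e = k")
      case False
      then have "{e\<in>E. rank e < Suc k} = {e\<in>E. rank e < k}" by (auto simp: less_Suc_eq)
      with Suc show ?thesis by simp
    next
      case True
      then obtain e where e: "e \<in> E" "rank e = k" by blast
      let ?F = "{e\<in>E. rank e < k}"
      have eq: "{e\<in>E. rank e < Suc k} = insert e ?F"
        using e assms(2) by (auto simp: less_Suc_eq inj_on_def)
      obtain s r where sr: "s \<in> Fd (x ` ?F)" "r \<in> Fd (x ` ?F)" "s \<noteq> 0" "h e = s * x e + r"
        using tri[OF e(1)] e by auto
      have "Transc (x e) (Fd (x ` ?F))"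
        by (rule alg_indep_insertD[OF alg_indep_mono[OF assms(3)]]) (use e in auto)
      then have "Transc (h e) (Fd (x ` ?F))"
        unfolding sr(4) using sr by (intro Transc_affine)
      moreover have "Fd (h ` ?F) \<subseteq> Fd (x ` ?F)"
        by (rule Fd_mono) (auto intro!: sub)
      ultimately show ?thesis
        unfolding eq using Suc e by (intro alg_indep_insertI) (auto elim: Transc_mono)
    qed
  qed
  moreover obtain k where "\<forall>e\<in>E. rank e < k"
    using assms(1) by (metis finite_imageI finite_nat_set_iff_bounded image_eqI)
  then have "{e\<in>E. rank e < k} = E" by auto
  ultimately show ?thesis by metis
qed

lemma alg_indep_vars: "alg_indep (\<lambda>v. rpoly (pvar v)) E"
  unfolding alg_indep_def using rpoly_eq_peval rpoly_eq_0 by metis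

section \<open>The crystal operators as field endomorphisms\<close>

lemma sigma_split:
  fixes u v :: "nat \<Rightarrow> 'a::field"
  assumes "1 \<le> j" "j \<le> n"
  shows "sigma n u v c j = sigma n u v c (j - 1) + (c - 1) * ((\<Prod>s\<in>{1..<j}. v s) * (\<Prod>s\<in>{j<..n}. u s))"
proof -
  let ?m = "\<lambda>r. (\<Prod>s\<in>{1..<r}. v s) * (\<Prod>s\<in>{r<..n}. u s)"
  have "sigma n u v c j - sigma n u v c (j - 1) =
      (\<Sum>r\<in>{1..n}. ((if r \<le> j then c else 1) - (if r \<le> j - 1 then c else 1)) * ?m r)"
    unfolding sigma_def sum_subtractf[symmetric] by (simp add: left_diff_distrib mult.assoc)
  also have "\<dots> = (\<Sum>r\<in>{1..n}. if r = j then (c - 1) * ?m j else 0)"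
    using assms by (intro sum.cong) auto
  also have "\<dots> = (c - 1) * ?m j" using assms by simp
  finally show ?thesis by (simp add: algebra_simps)
qed

text \<open>The two neighbours of sigma^j differ from it by multiples of one common product
  \<open>P\<close>, namely by -u^{j+1} P and v^j P. Divided by sigma^j, the identity says that the
  crystal operator preserves v^j + u^{j+1}.\<close>

lemma sigma_rel:
  fixes u v :: "nat \<Rightarrow> 'a::field"
  assumes "1 \<le> j" "j < n"
  shows "v j * sigma n u v c (j - 1) + u (Suc j) * sigma n u v c (Suc j) = (v j + u (Suc j)) * sigma n u v c j"
proof -
  define P where "P = (c - 1) * ((\<Prod>s\<in>{1..<j}. v s) * (\<Prod>s\<in>{Suc j<..n}. u s))"
  have "{1..<Suc j} = insert j {1..<j}" "{j<..n} = insert (Suc j) {Suc j<..n}"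
    using assms by auto
  then have "sigma n u v c (j - 1) = sigma n u v c j - u (Suc j) * P"
    "sigma n u v c (Suc j) = sigma n u v c j + v j * P"
    using sigma_split[of j n u v c] sigma_split[of "Suc j" n u v c] assms
    by (simp_all add: P_def mult_ac)
  then show ?thesis by (simp only:) (simp add: algebra_simps)
qed

text \<open>Every sigma^j is affine in c, so the ratios in the crystal operator are Moebius
  functions of c.\<close>

lemma sigma_moebius:
  fixes u v :: "nat \<Rightarrow> 'a::field"
  shows "sigma n u v c j = (\<Sum>r\<in>{r\<in>{1..n}. r \<le> j}. (\<Prod>s\<in>{1..<r}. v s) * (\<Prod>s\<in>{r<..n}. u s)) * c +
    (\<Sum>r\<in>{r\<in>{1..n}. j < r}. (\<Prod>s\<in>{1..<r}. v s) * (\<Prod>s\<in>{r<..n}. u s))"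
proof -
  have "sum f {1..n} = sum f {r\<in>{1..n}. r \<le> j} + sum f {r\<in>{1..n}. j < r}" for f :: "nat \<Rightarrow> 'a"
    by (subst sum.union_disjoint[symmetric]) (auto intro!: sum.cong)
  then show ?thesis
    unfolding sigma_def by (simp add: sum_distrib_right sum_distrib_left mult_ac)
qed

definition spoly :: "nat \<Rightarrow> nat \<Rightarrow> nat \<Rightarrow> var cpoly" where
  "spoly n i j = (\<Sum>r\<in>{1..n}. (if r \<le> j then pvar None else 1) *
      (\<Prod>s\<in>{1..<r}. pvar (Some (i + 1, s))) * (\<Prod>s\<in>{r<..n}. pvar (Some (i, s))))"

lemma sigma_eq_spoly: "sigma n (xv i) (xv (i + 1)) cv j = rpoly (spoly n i j)"
  unfolding sigma_def spoly_def xv_def cv_def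
  by (auto simp: rhom_sum[OF rhom_rpoly] rhom_mult[OF rhom_rpoly] rhom_prod[OF rhom_rpoly] rhom_1[OF rhom_rpoly]
      intro!: sum.cong)

section \<open>Specialization at c = 1\<close>

definition at1 :: "var cpoly \<Rightarrow> var cpoly" where
  "at1 = peval pconst (\<lambda>v. if v = None then 1 else pvar v)"

lemma rhom_at1: "rhom at1"
  unfolding at1_def by (rule rhom_peval[OF rhom_pconst])

lemma at1_pconst [simp]: "at1 (pconst c) = pconst c"
  and at1_pvar [simp]: "at1 (pvar v) = (if v = None then 1 else pvar v)"
  by (simp_all add: at1_def peval_pconst peval_pvar rhom_pconst)

text \<open>At c = 1 the index j is forgotten, so all ratios become 1 and e_i^c specializes to the
  identity.\<close>

lemma at1_spoly: "at1 (spoly n i j) = at1 (spoly n i 0)"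
  by (auto simp: spoly_def rhom_sum[OF rhom_at1] rhom_mult[OF rhom_at1] rhom_prod[OF rhom_at1]
      rhom_1[OF rhom_at1] intro!: sum.cong)

text \<open>Setting all variables to 1 counts the n monomials.\<close>

lemma at1_spoly_nonzero:
  assumes "1 \<le> n"
  shows "at1 (spoly n i j) \<noteq> 0"
proof
  note h = rhom_peval[OF rhom_id, of "\<lambda>_ :: var. 1"]
  assume "at1 (spoly n i j) = 0"
  then have "peval (\<lambda>c. c) (\<lambda>_. 1) (at1 (spoly n i 0)) = 0"
    using at1_spoly[of n i j] by (simp add: rhom_0[OF h])
  moreover have "peval (\<lambda>c. c) (\<lambda>_. 1) (at1 (spoly n i 0)) = of_nat n"
    by (simp add: spoly_def rhom_sum[OF rhom_at1] rhom_mult[OF rhom_at1] rhom_prod[OF rhom_at1]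
        rhom_1[OF rhom_at1] rhom_sum[OF h] rhom_mult[OF h] rhom_prod[OF h] rhom_1[OF h] peval_pvar[OF rhom_id])
  ultimately show False using assms by simp
qed

lemma sigma_nonzero: "1 \<le> n \<Longrightarrow> sigma n (xv i) (xv (i + 1)) cv j \<noteq> 0"
  using at1_spoly_nonzero[of n i j] unfolding sigma_eq_spoly by (auto simp: rhom_0[OF rhom_at1])

lemma xv_nonzero [simp]: "xv i j \<noteq> 0"
proof
  assume "xv i j = 0"
  then have "pvar (Some (i, j)) = (0 :: var cpoly)" by (simp add: xv_def)
  then have "pvars (pvar (Some (i, j))) = ({} :: var set)" by simp
  then show False by simp
qed

text \<open>
  e_i^c is extended to all variables by moving c and row 0 out of the way, so that it induces an
  injective endomorphism of the whole ambient field; injectivity is seen by putting c = 1.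
\<close>
definition evar :: "nat \<Rightarrow> nat \<Rightarrow> var \<Rightarrow> rfun" where
  "evar n i v = (case v of None \<Rightarrow> xv 0 0
     | Some (k, j) \<Rightarrow> if k = 0 then xv 0 (Suc j) else ecrys n i cv xv k j)"

definition shift :: "var \<Rightarrow> var" where
  "shift v = (case v of None \<Rightarrow> Some (0, 0)
     | Some (k, j) \<Rightarrow> if k = 0 then Some (0, Suc j) else Some (k, j))"

definition unshift :: "var \<Rightarrow> var" where
  "unshift v = (case v of None \<Rightarrow> None
     | Some (k, j) \<Rightarrow> if k = 0 then (if j = 0 then None else Some (0, j - 1)) else Some (k, j))"

lemma unshift_shift: "unshift (shift v) = v"
  by (auto simp: shift_def unshift_def split: option.splits)

abbreviation esub :: "nat \<Rightarrow> nat \<Rightarrow> var cpoly \<Rightarrow> rfun" where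
  "esub n i \<equiv> peval cst (evar n i)"

text \<open>The value at c = 1 of the rational function r exists and equals w.\<close>

definition spec1 :: "rfun \<Rightarrow> var cpoly \<Rightarrow> bool" where
  "spec1 r w \<longleftrightarrow> (\<exists>N D. r = rpoly N / rpoly D \<and> at1 D \<noteq> 0 \<and> at1 N = w * at1 D)"

lemma spec1_add: "spec1 r w \<Longrightarrow> spec1 s z \<Longrightarrow> spec1 (r + s) (w + z)"
  unfolding spec1_def
proof (elim exE conjE)
  fix N D N' D' assume *: "r = rpoly N / rpoly D" "at1 D \<noteq> 0" "at1 N = w * at1 D"
    "s = rpoly N' / rpoly D'" "at1 D' \<noteq> 0" "at1 N' = z * at1 D'"
  then have "D \<noteq> 0" "D' \<noteq> 0" by (auto simp: rhom_0[OF rhom_at1])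
  then have "r + s = rpoly (N * D' + N' * D) / rpoly (D * D')"
    using * by (simp add: rhom_add[OF rhom_rpoly] rhom_mult[OF rhom_rpoly] add_frac_eq)
  then show "\<exists>N D. r + s = rpoly N / rpoly D \<and> at1 D \<noteq> 0 \<and> at1 N = (w + z) * at1 D"
    using * by (intro exI[of _ "N * D' + N' * D"] exI[of _ "D * D'"])
      (simp add: rhom_add[OF rhom_at1] rhom_mult[OF rhom_at1] algebra_simps)
qed

lemma spec1_mult: "spec1 r w \<Longrightarrow> spec1 s z \<Longrightarrow> spec1 (r * s) (w * z)"
  unfolding spec1_def
proof (elim exE conjE)
  fix N D N' D' assume *: "r = rpoly N / rpoly D" "at1 D \<noteq> 0" "at1 N = w * at1 D"
    "s = rpoly N' / rpoly D'" "at1 D' \<noteq> 0" "at1 N' = z * at1 D'"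
  then show "\<exists>N D. r * s = rpoly N / rpoly D \<and> at1 D \<noteq> 0 \<and> at1 N = (w * z) * at1 D"
    by (intro exI[of _ "N * N'"] exI[of _ "D * D'"])
      (simp add: rhom_mult[OF rhom_rpoly] rhom_mult[OF rhom_at1] algebra_simps)
qed

lemma spec1_0: "spec1 0 w \<Longrightarrow> w = 0"
  by (auto simp: spec1_def rhom_0[OF rhom_at1])

lemma spec1_rpoly: "spec1 (rpoly p) (at1 p)"
  unfolding spec1_def by (intro exI[of _ p] exI[of _ 1]) (simp add: rhom_1[OF rhom_rpoly] rhom_1[OF rhom_at1])

lemma spec1_sigma_ratio:
  "1 \<le> n \<Longrightarrow> spec1 (sigma n (xv i) (xv (i + 1)) cv j / sigma n (xv i) (xv (i + 1)) cv k) 1"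
  unfolding spec1_def sigma_eq_spoly
  by (intro exI[of _ "spoly n i j"] exI[of _ "spoly n i k"])
    (use at1_spoly[of n i j] at1_spoly[of n i k] at1_spoly_nonzero in auto)

lemma spec1_evar:
  assumes "1 \<le> n" "1 \<le> i"
  shows "spec1 (evar n i v) (pvar (shift v))"
proof -
  have x: "spec1 (xv k j) (pvar (Some (k, j)))" for k j
    using spec1_rpoly[of "pvar (Some (k, j))"] by (simp add: xv_def)
  show ?thesis
  proof (cases v)
    case None
    then show ?thesis using x by (simp add: evar_def shift_def)
  next
    case (Some a)
    then obtain k j where v: "v = Some (k, j)" by (cases a) auto
    show ?thesis
      using x[of 0 "Suc j"] x[of k j] spec1_mult[OF spec1_sigma_ratio[OF assms(1)] x[of k j], of i]
      by (auto simp: v evar_def shift_def ecrys_def)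
  qed
qed

lemma esub_nonzero:
  assumes "1 \<le> n" "1 \<le> i" "p \<noteq> 0"
  shows "esub n i p \<noteq> 0"
proof
  assume 0: "esub n i p = 0"
  let ?r = "peval pconst (\<lambda>v. pvar (shift v)) :: var cpoly \<Rightarrow> var cpoly"
  note h = rhom_peval[OF rhom_cst, of "evar n i"] and hr = rhom_peval[OF rhom_pconst, of "\<lambda>v. pvar (shift v)"]
  have "pvars p \<subseteq> UNIV" by simp
  then have "spec1 (esub n i p) (?r p)"
  proof (induction rule: cpoly_induct)
    case (const c)
    then show ?case
      using spec1_rpoly[of "pconst c"] by (simp add: peval_pconst rhom_cst rhom_pconst flip: cst_eq)
  next
    case (var v)
    show ?case using spec1_evar[OF assms(1,2), of v] by (simp add: peval_pvar rhom_cst rhom_pconst)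
  next
    case (add p q)
    then show ?case unfolding rhom_add[OF h] rhom_add[OF hr] by (intro spec1_add)
  next
    case (mult p q)
    then show ?case unfolding rhom_mult[OF h] rhom_mult[OF hr] by (intro spec1_mult)
  qed
  then have "?r p = 0" unfolding 0 by (rule spec1_0)
  \<comment> \<open>At c = 1 the substitution only renames variables, and \<open>unshift\<close>
    recovers p.\<close>
  moreover have "peval pconst (\<lambda>v. pvar (unshift v)) (?r p) = p"
    by (rule rhom_cpoly_eqI[OF rhom_comp[OF rhom_peval[OF rhom_pconst] hr] rhom_id, of _ UNIV])
      (simp_all add: peval_pconst peval_pvar rhom_pconst unshift_shift)
  ultimately show False
    using assms(3) rhom_0[OF rhom_peval[OF rhom_pconst, of "\<lambda>v. pvar (unshift v)"]] by simp
qed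

text \<open>For positive n and i, \<open>esub_nonzero\<close> keeps denominators nonzero, so the
  value does not depend on the chosen fraction.\<close>

definition ehom :: "nat \<Rightarrow> nat \<Rightarrow> rfun \<Rightarrow> rfun" where
  "ehom n i f = (THE w. \<exists>p q. q \<noteq> 0 \<and> f = Fract p q \<and> w = esub n i p / esub n i q)"

lemma ehom_Fract:
  assumes "1 \<le> n" "1 \<le> i" "q \<noteq> 0"
  shows "ehom n i (Fract p q) = esub n i p / esub n i q"
  unfolding ehom_def
proof (rule the_equality)
  show "\<exists>p' q'. q' \<noteq> 0 \<and> Fract p q = Fract p' q' \<and> esub n i p / esub n i q = esub n i p' / esub n i q'"
    using assms(3) by blast
next
  fix w assume "\<exists>p' q'. q' \<noteq> 0 \<and> Fract p q = Fract p' q' \<and> w = esub n i p' / esub n i q'"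
  then obtain p' q' where *: "q' \<noteq> 0" "Fract p q = Fract p' q'" "w = esub n i p' / esub n i q'" by blast
  then have "esub n i (p * q') = esub n i (p' * q)" using assms(3) by (simp add: eq_fract)
  then show "w = esub n i p / esub n i q"
    using * assms esub_nonzero[OF assms(1,2)]
    by (simp add: rhom_mult[OF rhom_peval[OF rhom_cst]] frac_eq_eq)
qed

lemma ehom_rpoly:
  assumes "1 \<le> n" "1 \<le> i"
  shows "ehom n i (rpoly p) = esub n i p"
  using ehom_Fract[OF assms, of 1 p] by (simp add: rpoly_def rhom_1[OF rhom_peval[OF rhom_cst]])

lemma rhom_ehom:
  assumes "1 \<le> n" "1 \<le> i"
  shows "rhom (ehom n i)"
proof -
  note h = rhom_peval[OF rhom_cst, of "evar n i"] and nz = esub_nonzero[OF assms]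
  have *: "ehom n i (a + b) = ehom n i a + ehom n i b \<and> ehom n i (a * b) = ehom n i a * ehom n i b" for a b
  proof -
    obtain p q where a: "a = Fract p q" "q \<noteq> 0" by (cases a)
    obtain p' q' where b: "b = Fract p' q'" "q' \<noteq> 0" by (cases b)
    show ?thesis
      using a(2) b(2) nz
      by (simp add: a(1) b(1) ehom_Fract[OF assms] rhom_add[OF h] rhom_mult[OF h] add_frac_eq)
  qed
  have "ehom n i 1 = 1"
    using ehom_rpoly[OF assms, of 1] by (simp add: rhom_1[OF rhom_rpoly] rhom_1[OF h])
  with * show ?thesis by (simp add: rhom_def)
qed

lemma ehom_cst: "1 \<le> n \<Longrightarrow> 1 \<le> i \<Longrightarrow> ehom n i (cst c) = cst c"
  by (simp add: cst_eq ehom_rpoly peval_pconst rhom_cst)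

lemma ehom_xv: "1 \<le> n \<Longrightarrow> 1 \<le> i \<Longrightarrow> 1 \<le> k \<Longrightarrow> ehom n i (xv k j) = ecrys n i cv xv k j"
  unfolding xv_def[of k] by (simp add: ehom_rpoly peval_pvar rhom_cst evar_def)

lemma ehom_eq_0: "1 \<le> n \<Longrightarrow> 1 \<le> i \<Longrightarrow> ehom n i f = 0 \<longleftrightarrow> f = 0"
proof -
  assume *: "1 \<le> n" "1 \<le> i"
  have "f = 0" if "ehom n i f = 0"
  proof (rule ccontr)
    assume "f \<noteq> 0"
    then have "ehom n i 1 = ehom n i f * ehom n i (inverse f)"
      by (simp flip: rhom_mult[OF rhom_ehom[OF *]])
    then show False using that by (simp add: rhom_1[OF rhom_ehom[OF *]])
  qed
  then show ?thesis using rhom_0[OF rhom_ehom[OF *]] by auto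
qed

lemma ehom_inverse:
  assumes "1 \<le> n" "1 \<le> i"
  shows "ehom n i (inverse f) = inverse (ehom n i f)"
proof (cases "f = 0")
  case False
  then have "ehom n i f * ehom n i (inverse f) = 1"
    by (simp add: rhom_1[OF rhom_ehom[OF assms]] flip: rhom_mult[OF rhom_ehom[OF assms]])
  then show ?thesis by (metis inverse_unique)
qed (simp add: rhom_0[OF rhom_ehom[OF assms]])

lemma ehom_Fd:
  assumes "1 \<le> n" "1 \<le> i" "f \<in> Fd S"
  shows "ehom n i f \<in> Fd (ehom n i ` S)"
  using assms(3)
  by induction (auto simp: ehom_cst[OF assms(1,2)] ehom_inverse[OF assms(1,2)]
      rhom_add[OF rhom_ehom[OF assms(1,2)]] rhom_mult[OF rhom_ehom[OF assms(1,2)]] intro: Fd.intros)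

lemma esubst_eq_esub:
  assumes "pvars p \<subseteq> Xvars m n"
  shows "esubst n i p = esub n i p"
  unfolding esubst_def
  by (rule rhom_cpoly_eqI[OF rhom_peval rhom_peval assms])
    (auto simp: peval_pconst peval_pvar rhom_cst evar_def Xvars_def)

text \<open>On polynomials in the x_i^j the substitution \<open>esubst\<close> agrees with
  \<open>esub\<close>, since neither c nor row 0 occurs in them. The quantification over all
  representing fractions thus collapses to one equation in the ambient field.\<close>

lemma e_invariant_iff:
  assumes "1 \<le> n" "1 \<le> i" "f \<in> RatF m n"
  shows "e_invariant m n i f \<longleftrightarrow> ehom n i f = f"
proof -
  obtain p q where pq: "f = Fract p q" "q \<noteq> 0" "pvars p \<subseteq> Xvars m n" "pvars q \<subseteq> Xvars m n"
    using assms(3) by (auto simp: RatF_def)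
  have "esubst n i p' / esubst n i q' = ehom n i f"
    if "q' \<noteq> 0" "f = Fract p' q'" "pvars p' \<subseteq> Xvars m n" "pvars q' \<subseteq> Xvars m n" for p' q'
    using that by (simp add: ehom_Fract[OF assms(1,2)] esubst_eq_esub)
  then show ?thesis unfolding e_invariant_def using pq by metis
qed

section \<open>Entries of the matrix product\<close>

text \<open>Column n + 1 reads as zero, a boundary condition that spares the recursion
  \<open>Wprod_Suc\<close> a separate case b = n.\<close>

lemma Wprod_beyond: "a \<le> n \<Longrightarrow> n < b \<Longrightarrow> Wprod n x m a b = 0"
proof (cases m)
  case (Suc k)
  assume "a \<le> n" "n < b"
  then show ?thesis unfolding Suc Wprod.simps mmul_def
    by (intro sum.neutral) (auto simp: Wmat_def)
qed auto

lemma Wprod_Suc: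
  assumes "a \<le> n" "1 \<le> b"
  shows "Wprod n x (Suc m) a b = Wprod n x m a b * x (Suc m) b + Wprod n x m a (Suc b)"
proof (cases "b \<le> n")
  case True
  have "Wprod n x (Suc m) a b = (\<Sum>k\<in>{1..n}. (if k = b then Wprod n x m a b * x (Suc m) b else 0) +
      (if k = Suc b then Wprod n x m a (Suc b) else 0))"
    unfolding Wprod.simps mmul_def by (intro sum.cong) (auto simp: Wmat_def)
  also have "\<dots> = Wprod n x m a b * x (Suc m) b + (if Suc b \<le> n then Wprod n x m a (Suc b) else 0)"
    using True assms by (simp add: sum.distrib)
  finally show ?thesis using assms by (auto simp: Wprod_beyond not_le)
qed (use assms in \<open>simp add: Wprod_beyond del: Wprod.simps\<close>)

declare Wprod.simps(2) [simp del]

lemma Wprod_zero: "a \<le> n \<Longrightarrow> 1 \<le> b \<Longrightarrow> a < b \<or> b + m < a \<Longrightarrow> Wprod n x m a b = 0"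
  by (induction m arbitrary: b) (auto simp: Wprod_Suc)

lemma Wprod_one: "a \<le> n \<Longrightarrow> 1 \<le> b \<Longrightarrow> a = b + m \<Longrightarrow> Wprod n x m a b = 1"
  by (induction m arbitrary: b) (auto simp: Wprod_Suc Wprod_zero)

lemma Wprod_cong:
  assumes "\<And>k j. 1 \<le> k \<Longrightarrow> k \<le> m \<Longrightarrow> 1 \<le> j \<Longrightarrow> j \<le> n \<Longrightarrow> x k j = y k j" "a \<le> n" "1 \<le> b"
  shows "Wprod n x m a b = Wprod n y m a b"
  using assms(1,3)
proof (induction m arbitrary: b)
  case (Suc m)
  then show ?case using assms(2)
    by (cases "b \<le> n") (simp_all add: Wprod_Suc Wprod_beyond)
qed simp

text \<open>Column b of the product sees only variables from columns b, ..., n. This one-sidedness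
  is the source of the inductions over columns from right to left.\<close>

lemma Wprod_mem:
  assumes "subring A" "a \<le> n"
  shows "1 \<le> b \<Longrightarrow> (\<And>k j. 1 \<le> k \<Longrightarrow> k \<le> m \<Longrightarrow> b \<le> j \<Longrightarrow> j \<le> n \<Longrightarrow> x k j \<in> A) \<Longrightarrow> Wprod n x m a b \<in> A"
proof (induction m arbitrary: b)
  case 0
  then show ?case using assms by (auto intro: subring_intros)
next
  case (Suc m)
  show ?case
  proof (cases "b \<le> n")
    case True
    have "x (Suc m) b \<in> A" "Wprod n x m a b \<in> A" "Wprod n x m a (Suc b) \<in> A"
      using Suc True by auto
    then show ?thesis
      unfolding Wprod_Suc[OF assms(2) Suc.prems(1)] by (intro subring_add subring_mult assms)
  next
    case False
    then show ?thesis using assms by (simp add: Wprod_beyond subring_0)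
  qed
qed

lemma rhom_Wprod:
  assumes "rhom h" "a \<le> n" "1 \<le> b"
  shows "h (Wprod n x m a b) = Wprod n (\<lambda>k j. h (x k j)) m a b"
  using assms(3)
proof (induction m arbitrary: b)
  case 0
  then show ?case by (simp add: rhom_0[OF assms(1)] rhom_1[OF assms(1)])
next
  case (Suc m)
  then show ?case using assms(2) by (simp add: Wprod_Suc rhom_add[OF assms(1)] rhom_mult[OF assms(1)])
qed

lemma Wprod_crystal:
  assumes i: "1 \<le> i" and other: "\<And>k j. k \<noteq> i \<Longrightarrow> k \<noteq> Suc i \<Longrightarrow> 1 \<le> k \<Longrightarrow> x k j = y k j"
    and prod: "\<And>j. 1 \<le> j \<Longrightarrow> j \<le> n \<Longrightarrow> x i j * x (Suc i) j = y i j * y (Suc i) j"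
    and sum: "\<And>j. 1 \<le> j \<Longrightarrow> j < n \<Longrightarrow> x (Suc i) j + x i (Suc j) = y (Suc i) j + y i (Suc j)"
    and "a \<le> n" "1 \<le> b" "Suc i \<le> m"
  shows "Wprod n x m a b = Wprod n y m a b"
  using \<open>Suc i \<le> m\<close> \<open>1 \<le> b\<close>
proof (induction m arbitrary: b rule: dec_induct)
  case base
  obtain k where k: "i = Suc k" using i by (cases i) auto
  have c: "Wprod n x k a b = Wprod n y k a b" if "1 \<le> b" for b
    using assms(5) that k by (intro Wprod_cong other) auto
  have P0: "Wprod n y k a b = 0" if "n < b" for b
    using assms(5) that by (rule Wprod_beyond)
  have two: "Wprod n z (Suc i) a b = Wprod n z k a b * (z i b * z (Suc i) b) +
      Wprod n z k a (Suc b) * (z (Suc i) b + z i (Suc b)) + Wprod n z k a (Suc (Suc b))" for z :: "nat \<Rightarrow> nat \<Rightarrow> 'a"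
    using assms(5) base by (simp add: Wprod_Suc k algebra_simps)
  \<comment> \<open>In the last column the sum is multiplied by an entry of column n + 1, which is
    zero; hence the sums have to agree only for j < n.\<close>
  consider "b < n" | "b = n" | "n < b" by linarith
  then show ?case
    unfolding two using base c prod[of b] sum[of b] P0 by cases simp_all
next
  case (step m)
  then show ?case using assms(5) other[of "Suc m"] by (simp add: Wprod_Suc)
qed

lemma Rg_insert_absorb: "s \<in> Rg S \<Longrightarrow> Rg (insert s S) = Rg S"
  by (intro subset_antisym Rg_mono) (auto intro: Rg.gen)

lemma Fd_insert_absorb: "s \<in> Fd S \<Longrightarrow> Fd (insert s S) = Fd S"
  by (intro subset_antisym Fd_mono) (auto intro: Fd.gen)

lemma Fd_Rg_mono: "S \<subseteq> Rg T \<Longrightarrow> Fd S \<subseteq> Fd T"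
  using Rg_subset_Fd by (intro Fd_mono) blast

section \<open>Descent of polynomiality\<close>

definition saturated :: "rfun \<Rightarrow> rfun set \<Rightarrow> rfun set \<Rightarrow> bool" where
  "saturated d A C \<longleftrightarrow> d \<in> Rg A \<and> C \<subseteq> Rg A \<and> (\<forall>g\<in>Fd C. \<forall>r. g * d ^ r \<in> Rg A \<longrightarrow> g \<in> Rg C)"

lemma saturatedD: "saturated d A C \<Longrightarrow> g \<in> Fd C \<Longrightarrow> g * d ^ r \<in> Rg A \<Longrightarrow> g \<in> Rg C"
  by (auto simp: saturated_def)

lemma saturated_1: "saturated d A C \<Longrightarrow> saturated 1 A C"
  using saturatedD[of d A C _ 0] by (auto simp: saturated_def intro: Rg_intros)

lemma saturated_insert_absorb:
  assumes "saturated d A C" "s \<in> Rg A" "t \<in> Rg C"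
  shows "saturated d (insert s A) (insert t C)"
proof -
  have "t \<in> Rg A" using assms Rg_mono[of C A] by (auto simp: saturated_def)
  moreover have "t \<in> Fd C" using assms(3) Rg_subset_Fd by blast
  ultimately show ?thesis
    using assms by (auto simp: saturated_def Rg_insert_absorb Fd_insert_absorb)
qed

text \<open>As v is a free variable over \<open>A\<close>, the element g v^r is a polynomial in v
  with single coefficient g, and so g is in the ring of \<open>A\<close>.\<close>

lemma saturated_insert_unit:
  assumes "saturated 1 A C" "Transc v (Fd A)"
  shows "saturated v (insert v A) C"
proof -
  have CA: "C \<subseteq> Rg A" using assms(1) by (simp add: saturated_def)
  have "g \<in> Rg C" if g: "g \<in> Fd C" "g * v ^ r \<in> Rg (insert v A)" for g r
  proof -
    obtain p where p: "p \<in> Pol (Rg A)" "g * v ^ r = poly p v" using g(2) by (auto simp: Rg_insert)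
    have "g \<in> Fd A" using g(1) Fd_Rg_mono[OF CA] by blast
    then have "monom g r = p"
      using p Pol_mono[OF Rg_subset_Fd]
      by (intro Transc_eq[OF assms(2) subring_Fd]) (auto simp: poly_monom intro: Pol_monom subring_Fd)
    then have "coeff p r = g" by auto
    then have "g * 1 ^ 0 \<in> Rg A" using Pol_coeff[OF p(1), of r] by simp
    then show ?thesis using saturatedD[OF assms(1) g(1)] by blast
  qed
  then show ?thesis
    using CA Rg_mono[of A "insert v A"] unfolding saturated_def by (auto intro: Rg.gen)
qed

text \<open>With g = p(z)/q(z) the assumption becomes p (X - \<rho>)^r = q h. Since \<rho> is
  transcendental over the field of \<open>C\<close>, q(\<rho>) \<noteq> 0, so all r factors X -
  \<rho> divide h; being monic, they are divided out without denominators.\<close>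

lemma saturated_insert_shift:
  assumes sat: "saturated 1 A C" and "\<rho> \<in> Rg A" "Transc \<rho> (Fd C)" "Transc z (Fd A)"
  shows "saturated (z - \<rho>) (insert z A) (insert z C)"
proof -
  have CA: "C \<subseteq> Rg A" using sat by (simp add: saturated_def)
  have "g \<in> Rg (insert z C)" if g: "g \<in> Fd (insert z C)" "g * (z - \<rho>) ^ r \<in> Rg (insert z A)" for g r
  proof -
    obtain h where h: "h \<in> Pol (Rg A)" "g * (z - \<rho>) ^ r = poly h z" using g(2) by (auto simp: Rg_insert)
    obtain p q where pq: "p \<in> Pol (Fd C)" "q \<in> Pol (Fd C)" "poly q z \<noteq> 0" "g = poly p z / poly q z"
      using Fd_insert[OF g(1)] .
    have FA: "Pol (Fd C) \<subseteq> Pol (Fd A)" "Pol (Rg A) \<subseteq> Pol (Fd A)"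
      using Pol_mono[OF Fd_Rg_mono[OF CA]] Pol_mono[OF Rg_subset_Fd] by blast+
    have X: "[:-\<rho>, 1:] \<in> Pol (Fd A)"
      using assms(2) Rg_subset_Fd by (auto simp: Pol_pCons intro!: Fd_intros Pol_0 subring_Fd)
    have "q \<noteq> 0" using pq(3) by auto
    then have q\<rho>: "poly q \<rho> \<noteq> 0" using TranscD[OF assms(3) pq(2)] by blast
    have "p * [:-\<rho>, 1:] ^ r = q * h"
    proof (rule Transc_eq[OF assms(4) subring_Fd])
      show "p * [:-\<rho>, 1:] ^ r \<in> Pol (Fd A)" "q * h \<in> Pol (Fd A)"
        using pq h(1) FA X by (auto intro!: Pol_mult Pol_power subring_Fd)
      show "poly (p * [:-\<rho>, 1:] ^ r) z = poly (q * h) z"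
        using pq(3) h(2) by (simp add: pq(4) poly_power field_simps)
    qed
    then have "\<exists>h'\<in>Pol (Rg A). p = q * h'"
      using h(1)
    proof (induction r arbitrary: h)
      case (Suc r)
      have "poly q \<rho> * poly h \<rho> = poly (p * [:-\<rho>, 1:] ^ Suc r) \<rho>"
        unfolding Suc.prems(1) by simp
      then have "poly h \<rho> = 0" using q\<rho> by simp
      then have h': "h = [:-\<rho>, 1:] * synthetic_div h \<rho>"
        using synthetic_div_correct'[of \<rho> h] by simp
      have "[:-\<rho>, 1:] * (p * [:-\<rho>, 1:] ^ r) = p * [:-\<rho>, 1:] ^ Suc r"
        by (simp only: power_Suc mult.left_commute)
      also have "\<dots> = q * ([:-\<rho>, 1:] * synthetic_div h \<rho>)"
        unfolding Suc.prems(1) by (rule arg_cong[OF h'])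
      also have "\<dots> = [:-\<rho>, 1:] * (q * synthetic_div h \<rho>)"
        by (rule mult.left_commute)
      finally have "p * [:-\<rho>, 1:] ^ r = q * synthetic_div h \<rho>"
        by (simp only: mult_cancel_left pCons_eq_0_iff one_neq_zero simp_thms)
      then show ?case
        using Pol_synthetic_div[OF subring_Rg Suc.prems(2) assms(2)] by (rule Suc.IH)
    qed auto
    then obtain h' where h': "h' \<in> Pol (Rg A)" "p = q * h'" by blast
    then have gh: "g = poly h' z" using pq by simp
    \<comment> \<open>The coefficients of h' lie in the ring of \<open>A\<close> and also in the
      field of \<open>C\<close>, so saturation with exponent 0 applies to each of them.\<close>
    have "h' \<in> Pol (Fd C)"
      by (rule Fd_insert_poly[OF assms(4) subring_Fd Fd_Rg_mono[OF CA]]) (use h' FA gh g(1) in auto)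
    then have "h' \<in> Pol (Rg C)"
      using h'(1) saturatedD[OF sat, of _ 0] by (auto simp: Pol_def)
    then show ?thesis by (auto simp: gh Rg_insert)
  qed
  moreover have "z - \<rho> \<in> Rg (insert z A)" "insert z C \<subseteq> Rg (insert z A)"
    using CA assms(2) Rg_mono[of A "insert z A"] by (auto intro: Rg_intros Rg.gen)
  ultimately show ?thesis unfolding saturated_def by blast
qed

text \<open>Formally this is h((z - \<rho>)/d) at z = y d + \<rho>, with the denominators cleared in
  the manner of Horner's scheme.\<close>

lemma homogenize:
  assumes "h \<in> Pol (Rg A)" "d \<in> Rg A" "\<rho> \<in> Rg A"
  shows "\<exists>N. \<exists>H\<in>Pol (Rg A). poly H (y * d + \<rho>) = d ^ N * poly h y"
  using assms(1)
proof (induction h)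
  case 0
  show ?case by (intro exI[of _ 0] bexI[of _ 0]) (auto intro: Pol_0 subring_Rg)
next
  case (pCons a h)
  then obtain N H where H: "H \<in> Pol (Rg A)" "poly H (y * d + \<rho>) = d ^ N * poly h y"
    by (auto simp: Pol_pCons)
  show ?case
  proof (intro exI[of _ "Suc N"] bexI[of _ "[:a * d ^ Suc N:] + [:-\<rho>, 1:] * H"])
    have "poly ([:a * d ^ Suc N:] + [:-\<rho>, 1:] * H) (y * d + \<rho>) = a * d ^ Suc N + y * d * poly H (y * d + \<rho>)"
      by (simp add: algebra_simps)
    also have "\<dots> = d ^ Suc N * poly (pCons a h) y"
      unfolding H(2) by (simp add: algebra_simps)
    finally show "poly ([:a * d ^ Suc N:] + [:-\<rho>, 1:] * H) (y * d + \<rho>) = d ^ Suc N * poly (pCons a h) y" .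
    have "[:a * d ^ Suc N:] \<in> Pol (Rg A)" "[:-\<rho>, 1:] \<in> Pol (Rg A)"
      using pCons(3) assms(2,3) by (auto simp: Pol_pCons simp del: power_Suc intro!: Rg_intros Pol_0 subring_Rg)
    then show "[:a * d ^ Suc N:] + [:-\<rho>, 1:] * H \<in> Pol (Rg A)"
      using H(1) by (intro Pol_add Pol_mult subring_Rg)
  qed
qed

text \<open>In terms of z = y d + \<rho> the element g is a polynomial \<open>G\<close> whose
  coefficients have denominator d^(r+N). They lie in the field of \<open>C\<close> by
  \<open>Fd_insert_poly\<close>, and saturation with respect to powers of d puts them into the ring
  of \<open>C\<close>.\<close>

lemma saturated_insert_affine:
  assumes sat: "saturated d A C" and "d \<noteq> 0" "\<rho> \<in> Rg A" "Transc y (Fd A)"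
  shows "saturated d (insert y A) (insert (y * d + \<rho>) C)"
proof -
  let ?z = "y * d + \<rho>"
  have CA: "C \<subseteq> Rg A" and d: "d \<in> Rg A" using sat by (simp_all add: saturated_def)
  have AA: "Rg A \<subseteq> Rg (insert y A)" by (rule Rg_mono) (auto intro: Rg.gen)
  have z: "Transc ?z (Fd A)"
    using Transc_affine[OF assms(4), of d \<rho>] d assms(2,3) Rg_subset_Fd by (auto simp: mult.commute)
  have "g \<in> Rg (insert ?z C)" if g: "g \<in> Fd (insert ?z C)" "g * d ^ r \<in> Rg (insert y A)" for g r
  proof -
    obtain h where h: "h \<in> Pol (Rg A)" "g * d ^ r = poly h y" using g(2) by (auto simp: Rg_insert)
    obtain N H where H: "H \<in> Pol (Rg A)" "poly H ?z = d ^ N * poly h y"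
      using homogenize[OF h(1) d assms(3), of y] by blast
    define G where "G = smult (inverse (d ^ (r + N))) H"
    have gG: "g = poly G ?z"
      using assms(2) H(2) by (simp add: G_def field_simps power_add flip: h(2))
    have "inverse (d ^ (r + N)) \<in> Fd A"
      using d Rg_subset_Fd by (intro Fd.inverse Fd_intros) auto
    then have "G \<in> Pol (Fd A)"
      using H(1) Pol_mono[OF Rg_subset_Fd] unfolding G_def by (intro Pol_smult subring_Fd) auto
    then have "G \<in> Pol (Fd C)"
      using Fd_insert_poly[OF z subring_Fd Fd_Rg_mono[OF CA]] g(1) gG by simp
    moreover have "coeff G i * d ^ (r + N) \<in> Rg A" for i
      using Pol_coeff[OF H(1), of i] assms(2) by (simp add: G_def field_simps)
    ultimately have "G \<in> Pol (Rg C)"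
      using saturatedD[OF sat] unfolding Pol_def by blast
    then show ?thesis by (auto simp: gG Rg_insert)
  qed
  moreover have "d \<in> Rg (insert y A)" "insert ?z C \<subseteq> Rg (insert y A)"
    using CA d assms(3) AA by (auto intro!: Rg_intros intro: Rg.gen)
  ultimately show ?thesis unfolding saturated_def by blast
qed

section \<open>The tower of fields\<close>

text \<open>Only the number of columns is fixed: the length m of the product climbs up to the number
  L of rows.\<close>

locale crystal =
  fixes n :: nat
  assumes n: "1 \<le> n"
begin

abbreviation "Z m \<equiv> Wprod n xv m"

lemma ehom_row:
  assumes "1 \<le> i"
  shows "ehom n i (xv i j) = sigma n (xv i) (xv (i+1)) cv j / sigma n (xv i) (xv (i+1)) cv (j - 1) * xv i j"
    and "ehom n i (xv (Suc i) j) =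
      sigma n (xv i) (xv (i+1)) cv (j - 1) / sigma n (xv i) (xv (i+1)) cv j * xv (Suc i) j"
    and "1 \<le> k \<Longrightarrow> k \<noteq> i \<Longrightarrow> k \<noteq> Suc i \<Longrightarrow> ehom n i (xv k j) = xv k j"
  using assms by (simp_all add: ehom_xv[OF n assms] ecrys_def)

lemma ehom_row_prod:
  assumes "1 \<le> i"
  shows "ehom n i (xv i j) * ehom n i (xv (Suc i) j) = xv i j * xv (Suc i) j"
  using sigma_nonzero[OF n, of i] by (simp add: ehom_row[OF assms])

lemma ehom_row_sum:
  assumes "1 \<le> i" "1 \<le> j" "j < n"
  shows "ehom n i (xv (Suc i) j) + ehom n i (xv i (Suc j)) = xv (Suc i) j + xv i (Suc j)"
proof -
  let ?s = "sigma n (xv i) (xv (i+1)) cv"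
  have "xv (Suc i) j * ?s (j - 1) + xv i (Suc j) * ?s (Suc j) = (xv (Suc i) j + xv i (Suc j)) * ?s j"
    using sigma_rel[OF assms(2,3), of "xv (Suc i)" "xv i" cv] by simp
  then have "(xv (Suc i) j * ?s (j - 1) + xv i (Suc j) * ?s (Suc j)) / ?s j = xv (Suc i) j + xv i (Suc j)"
    using sigma_nonzero[OF n, of i j] by simp
  then show ?thesis by (simp add: ehom_row[OF assms(1)] add_divide_distrib mult.commute)
qed

lemma ehom_Z:
  assumes "1 \<le> i" "Suc i \<le> m" "a \<le> n" "1 \<le> b"
  shows "ehom n i (Z m a b) = Z m a b"
  unfolding rhom_Wprod[OF rhom_ehom[OF n assms(1)] assms(3,4)]
  by (rule Wprod_crystal[OF assms(1)])
    (use assms ehom_row(3) ehom_row_prod ehom_row_sum in \<open>simp_all\<close>)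

abbreviation "gv \<equiv> \<lambda>v :: var. rpoly (pvar v)"

lemma xv_eq: "xv i j = gv (Some (i, j))" and cv_eq: "cv = gv None"
  by (simp_all add: xv_def cv_def)

section \<open>An independent system containing the entries of the product\<close>

definition later :: "nat \<Rightarrow> nat \<Rightarrow> nat \<Rightarrow> var set" where
  "later m b d = {Some (i, j) | i j. 1 \<le> i \<and> i \<le> m \<and> 1 \<le> j \<and> j \<le> n \<and> (b < j \<or> b = j \<and> d < i)}"

text \<open>The entry in row b + d of column b is 1 in the product of d factors. The next factor
  adds x_{d+1}^b, and each further one multiplies by its x_i^b and adds terms from columns beyond b.
  So s is the product of the x_i^b with d + 1 < i \<le> m.\<close>

lemma Z_leading:
  assumes "b + d \<le> n" "1 \<le> b"
  shows "d < m \<Longrightarrow> \<exists>s r. s \<in> Fd (gv ` later m b (Suc d)) \<and> r \<in> Fd (gv ` later m b (Suc d)) \<and>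
    s \<noteq> 0 \<and> Z m (b + d) b = s * xv (Suc d) b + r"
proof (induction m)
  case (Suc m)
  have r: "Z m (b + d) (Suc b) \<in> Fd (gv ` later (Suc m) b (Suc d))"
    unfolding xv_eq[abs_def] using assms
    by (intro Wprod_mem[OF subring_Fd] Fd.gen imageI) (auto simp: later_def)
  have eq: "Z (Suc m) (b + d) b = Z m (b + d) b * xv (Suc m) b + Z m (b + d) (Suc b)"
    using assms by (simp add: Wprod_Suc)
  show ?case
  proof (cases "d = m")
    case True
    then show ?thesis using r eq assms
      by (intro exI[of _ 1] exI[of _ "Z m (b + d) (Suc b)"]) (auto simp: Wprod_one intro: Fd_intros)
  next
    case False
    then obtain s t where st: "s \<in> Fd (gv ` later m b (Suc d))" "t \<in> Fd (gv ` later m b (Suc d))"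
      "s \<noteq> 0" "Z m (b + d) b = s * xv (Suc d) b + t" using Suc by auto
    have "Fd (gv ` later m b (Suc d)) \<subseteq> Fd (gv ` later (Suc m) b (Suc d))"
      by (rule Fd_mono) (force simp: later_def intro: Fd.gen)
    with st have st': "s \<in> Fd (gv ` later (Suc m) b (Suc d))" "t \<in> Fd (gv ` later (Suc m) b (Suc d))"
      by auto
    have x: "xv (Suc m) b \<in> Fd (gv ` later (Suc m) b (Suc d))"
      unfolding xv_eq using False Suc.prems assms by (intro Fd.gen imageI) (auto simp: later_def)
    have "Z (Suc m) (b + d) b = (s * xv (Suc m) b) * xv (Suc d) b +
        (t * xv (Suc m) b + Z m (b + d) (Suc b))"
      unfolding eq st(4) by (simp add: algebra_simps)
    moreover have "s * xv (Suc m) b \<noteq> 0" using st(3) by simp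
    ultimately show ?thesis
      using Fd.mult[OF st'(1) x] Fd.add[OF Fd.mult[OF st'(2) x] r] by blast
  qed
qed simp

text \<open>
  The variable x_i^b is replaced by the entry of W(x_1)...W(x_m) in which it occurs linearly with
  all other variables in columns beyond b or in rows beyond i of column b.
\<close>

definition fam :: "nat \<Rightarrow> var \<Rightarrow> rfun" where
  "fam m v = (case v of None \<Rightarrow> cv
     | Some (i, b) \<Rightarrow> if i \<le> m \<and> i + b \<le> Suc n then Z m (b + i - 1) b else xv i b)"

lemma finite_Xvars: "finite (Xvars L n)"
proof -
  have "Xvars L n = Some ` ({1..L} \<times> {1..n})" by (auto simp: Xvars_def)
  then show ?thesis by simp
qed

lemma alg_indep_fam:
  assumes "m \<le> L"
  shows "alg_indep (fam m) (insert None (Xvars L n))"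
proof (rule alg_indep_triangular)
  \<comment> \<open>Columns run from right to left and each column from the bottom row upwards. The
    factor \<open>Suc L\<close> exceeds every row contribution \<open>L - i\<close>, and the summand
    1 reserves rank 0 for c.\<close>
  define rank where "rank v = (case v of None \<Rightarrow> 0
     | Some (i, j) \<Rightarrow> 1 + (n - j) * Suc L + (L - i))" for v :: var
  have less: "rank (Some (i', j')) < rank (Some (i, j))"
    if "j < j' \<or> j = j' \<and> i < i'" "1 \<le> i" "i' \<le> L" "j' \<le> n" for i j i' j'
  proof (cases "j < j'")
    case True
    then have "Suc (n - j') \<le> n - j" using that by simp
    then have "Suc (n - j') * Suc L \<le> (n - j) * Suc L" by (rule mult_right_mono) simp
    then have "(n - j') * Suc L + Suc L \<le> (n - j) * Suc L" by simp
    moreover have "L - i' \<le> L" by simp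
    ultimately show ?thesis unfolding rank_def option.case prod.case by linarith
  next
    case False
    then have "j = j'" "L - i' < L - i" using that by auto
    then show ?thesis unfolding rank_def option.case prod.case by simp
  qed
  show "inj_on rank (insert None (Xvars L n))"
  proof (rule inj_onI)
    fix v w assume *: "v \<in> insert None (Xvars L n)" "w \<in> insert None (Xvars L n)" "rank v = rank w"
    show "v = w"
    proof (cases v; cases w)
      fix p q assume "v = Some p" "w = Some q"
      then obtain i j i' j' where ij: "v = Some (i, j)" "w = Some (i', j')" "1 \<le> i" "i \<le> L" "1 \<le> i'" "i' \<le> L"
        "j \<le> n" "j' \<le> n" using *(1,2) by (auto simp: Xvars_def)
      then have "\<not> (j < j' \<or> j = j' \<and> i < i')" "\<not> (j' < j \<or> j' = j \<and> i' < i)"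
        using less[of j j' i i'] less[of j' j i' i] *(3) by auto
      then show ?thesis using ij by auto
    qed (use *(3) in \<open>auto simp: rank_def\<close>)
  qed
  show "finite (insert None (Xvars L n))" by (simp add: finite_Xvars)
  show "alg_indep gv (insert None (Xvars L n))" by (rule alg_indep_vars)
  fix e assume e: "e \<in> insert None (Xvars L n)"
  let ?F = "Fd (gv ` {d \<in> insert None (Xvars L n). rank d < rank e})"
  show "\<exists>s r. s \<in> ?F \<and> r \<in> ?F \<and> s \<noteq> 0 \<and> fam m e = s * gv e + r"
  proof (cases "\<exists>i b. e = Some (i, b) \<and> i \<le> m \<and> i + b \<le> Suc n")
    case False
    then have "fam m e = 1 * gv e + 0"
      by (cases e) (auto simp: fam_def xv_eq cv_eq)
    then show ?thesis by (intro exI[of _ 1] exI[of _ 0]) (auto intro: Fd_intros)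
  next
    case True
    then obtain i b where ib: "e = Some (i, b)" "i \<le> m" "i + b \<le> Suc n" by blast
    then have ge: "1 \<le> i" "1 \<le> b" "b \<le> n" using e by (auto simp: Xvars_def)
    then obtain d where d: "i = Suc d" by (cases i) auto
    have sub: "Fd (gv ` later m b (Suc d)) \<subseteq> ?F"
      using assms ge less[of b _ i] ib d by (intro Fd_mono image_subsetI Fd.gen imageI)
        (auto simp: later_def Xvars_def)
    have "\<exists>s r. s \<in> Fd (gv ` later m b (Suc d)) \<and> r \<in> Fd (gv ` later m b (Suc d)) \<and>
        s \<noteq> 0 \<and> Z m (b + d) b = s * xv (Suc d) b + r"
      by (rule Z_leading) (use ib ge d in auto)
    moreover have "fam m e = Z m (b + d) b" "gv e = xv (Suc d) b"
      using ib d by (simp_all add: fam_def xv_eq)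
    ultimately show ?thesis using sub by (simp only:) blast
  qed
qed

lemma xv_mem: "1 \<le> i \<Longrightarrow> i \<le> L \<Longrightarrow> 1 \<le> j \<Longrightarrow> j \<le> n \<Longrightarrow> xv i j \<in> Fd (gv ` Xvars L n)"
  unfolding xv_def by (intro Fd.gen imageI) (auto simp: Xvars_def)

lemma xv_mem_Rg: "1 \<le> i \<Longrightarrow> i \<le> L \<Longrightarrow> 1 \<le> j \<Longrightarrow> j \<le> n \<Longrightarrow> xv i j \<in> Rg (gv ` Xvars L n)"
  unfolding xv_def by (intro Rg.gen imageI) (auto simp: Xvars_def)

text \<open>The generators of the field F_m of the introduction, for matrices with L rows.\<close>

definition gens :: "nat \<Rightarrow> nat \<Rightarrow> rfun set" where
  "gens L m = {Z m a b | a b. 1 \<le> a \<and> a \<le> n \<and> 1 \<le> b \<and> b \<le> n} \<union> {xv i j | i j. m < i \<and> i \<le> L \<and> 1 \<le> j \<and> j \<le> n}"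

lemma gens_Z: "1 \<le> a \<Longrightarrow> a \<le> n \<Longrightarrow> 1 \<le> b \<Longrightarrow> b \<le> n \<Longrightarrow> Z m a b \<in> gens L m"
  and gens_xv: "m < i \<Longrightarrow> i \<le> L \<Longrightarrow> 1 \<le> j \<Longrightarrow> j \<le> n \<Longrightarrow> xv i j \<in> gens L m"
  by (auto simp: gens_def)

lemma gens_subset_Rg:
  assumes "m \<le> L"
  shows "gens L m \<subseteq> Rg (gv ` Xvars L n)"
  unfolding gens_def using assms
  by (auto intro!: Wprod_mem[OF subring_Rg] xv_mem_Rg)

lemma xv_fam: "m < i \<Longrightarrow> Some (i, j) \<in> V \<Longrightarrow> xv i j \<in> Rg (fam m ` V)"
  by (intro Rg.gen image_eqI[of _ _ "Some (i, j)"]) (auto simp: fam_def)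

lemma Z_fam:
  assumes "a \<le> n" "1 \<le> b" "b \<le> a \<Longrightarrow> a < b + m \<Longrightarrow> Some (Suc a - b, b) \<in> V"
  shows "Z m a b \<in> Rg (fam m ` V)"
proof -
  consider "a < b \<or> b + m < a" | "a = b + m" | "b \<le> a \<and> a < b + m" by linarith
  then show ?thesis
  proof cases
    case 3
    then show ?thesis using assms
      by (intro Rg.gen image_eqI[of _ _ "Some (Suc a - b, b)"]) (auto simp: fam_def)
  qed (use assms in \<open>auto simp: Wprod_zero Wprod_one intro: Rg_intros\<close>)
qed

text \<open>The positions with i \<le> m and i + b > n + 1 are left out: their variables are
  independent over F_m, and \<open>Transc_row\<close> draws on them.\<close>

lemma gens_subset_fam:
  assumes "m \<le> L"
  shows "gens L m \<subseteq> Rg (fam m ` {Some (i, b) | i b. Some (i, b) \<in> Xvars L n \<and> (m < i \<or> i + b \<le> Suc n)})"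
  unfolding gens_def using assms by (auto simp: Xvars_def intro!: xv_fam Z_fam)

lemma fam_mem:
  assumes "m \<le> L" "v \<in> Xvars L n"
  shows "fam m v \<in> Fd (gv ` Xvars L n)"
proof -
  obtain i j where v: "v = Some (i, j)" "1 \<le> i" "i \<le> L" "1 \<le> j" "j \<le> n"
    using assms by (auto simp: Xvars_def)
  show ?thesis
  proof (cases "i \<le> m \<and> i + j \<le> Suc n")
    case True
    then have "Z m (j + i - 1) j \<in> Fd (gv ` Xvars L n)"
      using v assms by (intro Wprod_mem[OF subring_Fd] xv_mem) auto
    then show ?thesis using True v by (simp add: fam_def)
  next
    case False
    then have "fam m v = xv i j" using v by (auto simp: fam_def)
    then show ?thesis using v xv_mem by simp
  qed
qed

section \<open>Transcendence of the images under a crystal operator\<close>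

lemma Transc_cv: "Transc cv (Fd (gv ` Xvars L n))"
  unfolding cv_def by (rule alg_indep_insertD[OF alg_indep_vars]) (auto simp: Xvars_def)

text \<open>This sum is the value of every sigma^j at c = 1.\<close>

lemma total_nonzero:
  "(\<Sum>r\<in>{1..n}. (\<Prod>s\<in>{1..<r}. xv (i+1) s) * (\<Prod>s\<in>{r<..n}. xv i s)) \<noteq> 0"
proof -
  have "(\<Sum>r\<in>{1..n}. (\<Prod>s\<in>{1..<r}. xv (i+1) s) * (\<Prod>s\<in>{r<..n}. xv i s)) = rpoly (at1 (spoly n i 0))"
    by (simp add: spoly_def rhom_sum[OF rhom_at1] rhom_mult[OF rhom_at1] rhom_prod[OF rhom_at1]
        rhom_1[OF rhom_at1] rhom_sum[OF rhom_rpoly] rhom_mult[OF rhom_rpoly] rhom_prod[OF rhom_rpoly]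
        rhom_1[OF rhom_rpoly] xv_def)
  then show ?thesis using at1_spoly_nonzero[OF n, of i 0] by simp
qed

text \<open>With sigma^j = A_j c + B_j the image is a Moebius function of c over C(x). Up to sign,
  its determinant is x_{i+1}^b times the b-th monomial of sigma times the value of sigma at c =
  1.\<close>

lemma Transc_ehom_row:
  assumes "1 \<le> i" "Suc i \<le> L" "1 \<le> b" "b \<le> n"
  shows "Transc (ehom n i (xv (Suc i) b)) (Fd (gv ` Xvars L n))"
proof -
  define q where "q r = (\<Prod>s\<in>{1..<r}. xv (i+1) s) * (\<Prod>s\<in>{r<..n}. xv i s)" for r
  define A where "A j = (\<Sum>r\<in>{r\<in>{1..n}. r \<le> j}. q r)" for j
  define B where "B j = (\<Sum>r\<in>{r\<in>{1..n}. j < r}. q r)" for j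
  have sig: "sigma n (xv i) (xv (i+1)) cv j = A j * cv + B j" for j
    unfolding A_def B_def q_def by (rule sigma_moebius)
  have A: "A b = A (b - 1) + q b"
  proof -
    have "{r\<in>{1..n}. r \<le> b} = insert b {r\<in>{1..n}. r \<le> b - 1}" using assms by auto
    moreover have "b \<notin> {r\<in>{1..n}. r \<le> b - 1}" using assms by auto
    ultimately show ?thesis unfolding A_def by simp
  qed
  have B: "B (b - 1) = B b + q b"
  proof -
    have "{r\<in>{1..n}. b - 1 < r} = insert b {r\<in>{1..n}. b < r}" using assms by auto
    moreover have "b \<notin> {r\<in>{1..n}. b < r}" by auto
    ultimately show ?thesis unfolding B_def by simp
  qed
  have "A b + B b = (\<Sum>r\<in>{1..n}. q r)"
    unfolding A_def B_def by (subst sum.union_disjoint[symmetric]) (auto intro!: sum.cong)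
  then have T: "A b + B b \<noteq> 0" using total_nonzero[of i] by (simp add: q_def)
  have q0: "q b \<noteq> 0" by (simp add: q_def)
  let ?v = "xv (Suc i) b"
  have "q r \<in> Fd (gv ` Xvars L n)" if "1 \<le> r" "r \<le> n" for r
    unfolding q_def using assms that by (intro Fd.mult subring_prod[OF subring_Fd] xv_mem) auto
  then have mem: "A j \<in> Fd (gv ` Xvars L n)" "B j \<in> Fd (gv ` Xvars L n)" for j
    unfolding A_def B_def by (auto intro!: subring_sum[OF subring_Fd])
  have v: "?v \<in> Fd (gv ` Xvars L n)" using assms by (intro xv_mem) auto
  have det: "(?v * A (b - 1)) * B b - (?v * B (b - 1)) * A b = - (?v * q b * (A b + B b))"
    unfolding A B by (simp add: algebra_simps)
  have "Transc ((?v * A (b - 1) * cv + ?v * B (b - 1)) / (A b * cv + B b)) (Fd (gv ` Xvars L n))"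
    by (rule Transc_moebius[OF Transc_cv]) (use mem v det T q0 in \<open>auto intro!: Fd.mult\<close>)
  moreover have "ehom n i ?v = (?v * A (b - 1) * cv + ?v * B (b - 1)) / (A b * cv + B b)"
    unfolding ehom_row(2)[OF assms(1)] sig by (simp add: algebra_simps)
  ultimately show ?thesis by simp
qed

text \<open>
  The columns in which adding row m gives no new nontrivial entry of the product, so that
  x_m^b is lost; these are the v_b of the introduction.
\<close>

definition top_cols :: "nat \<Rightarrow> nat set" where
  "top_cols m = {b. 1 \<le> b \<and> b \<le> n \<and> Suc n < b + m}"

text \<open>Columns are recovered from right to left. For b + m \<le> n the new entry in row b + m
  is x_{m+1}^b plus an old entry of column b + 1; for other b the variable x_{m+1}^b is adjoined.
  Once it is known, the recursion is solved for the old column b.\<close>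

lemma gens_step:
  assumes "Suc m \<le> L"
  shows "gens L m \<subseteq> Fd (gens L (Suc m) \<union> xv (Suc m) ` top_cols (Suc m))" (is "_ \<subseteq> ?H")
proof -
  have Zm: "Z (Suc m) a b \<in> ?H" if "1 \<le> a" "a \<le> n" "1 \<le> b" "b \<le> n" for a b
    using that by (intro Fd.gen UnI1 gens_Z)
  have col: "(\<forall>a. 1 \<le> a \<longrightarrow> a \<le> n \<longrightarrow> Z m a b \<in> ?H) \<and> (b \<le> n \<longrightarrow> xv (Suc m) b \<in> ?H)"
    if "b \<le> Suc n" "1 \<le> b" for b
    using that
  proof (induction b rule: inc_induct)
    case base
    then show ?case by (auto simp: Wprod_beyond intro: Fd_intros)
  next
    case (step b)
    have IH: "Z m a (Suc b) \<in> ?H" if "1 \<le> a" "a \<le> n" for a using step that by auto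
    have eq: "Z (Suc m) a b = Z m a b * xv (Suc m) b + Z m a (Suc b)" if "a \<le> n" for a
      using that step by (intro Wprod_Suc) auto
    have v: "xv (Suc m) b \<in> ?H"
    proof (cases "b \<in> top_cols (Suc m)")
      case False
      then have "b + m \<le> n" using step by (auto simp: top_cols_def)
      then have "xv (Suc m) b = Z (Suc m) (b + m) b - Z m (b + m) (Suc b)"
        using step eq[of "b + m"] by (simp add: Wprod_one)
      then show ?thesis
        using Zm[of "b + m" b] IH[of "b + m"] step \<open>b + m \<le> n\<close> by (simp add: Fd_intros)
    qed (auto intro: Fd.gen)
    have "Z m a b \<in> ?H" if "1 \<le> a" "a \<le> n" for a
    proof -
      have "Z m a b = (Z (Suc m) a b - Z m a (Suc b)) / xv (Suc m) b"
        using that by (simp add: eq)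
      then show ?thesis using Zm[of a b] IH[of a] v that step by (simp add: Fd_divide Fd_intros)
    qed
    with v show ?case by blast
  qed
  show ?thesis
  proof
    fix f assume "f \<in> gens L m"
    then consider a b where "f = Z m a b" "1 \<le> a" "a \<le> n" "1 \<le> b" "b \<le> n"
      | j where "f = xv (Suc m) j" "1 \<le> j" "j \<le> n"
      | i j where "f = xv i j" "Suc m < i" "i \<le> L" "1 \<le> j" "j \<le> n"
      unfolding gens_def by (auto simp: less_Suc_eq) (metis Suc_lessI)
    then show "f \<in> ?H"
    proof cases
      case 3
      then show ?thesis by (auto intro!: Fd.gen gens_xv)
    qed (use col in auto)
  qed
qed

text \<open>Since j + m > n, position (m, j+1) keeps its variable in \<open>fam m\<close>, and the
  generators of F_m do not involve it. The image t_n, transcendental over C(x), takes the place of c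
  in the independent family.\<close>

lemma Transc_row:
  assumes "1 \<le> m" "Suc m \<le> L" "j \<in> top_cols (Suc m)" "j < n"
  shows "Transc (xv m (Suc j))
    (Fd (gens L m \<union> {ehom n m (xv (Suc m) n)} \<union> {xv m b | b. Suc j < b \<and> b \<le> n}))"
proof -
  define t where "t = ehom n m (xv (Suc m) n)"
  define g where "g = (fam m)(None := t)"
  let ?X = "Xvars L n" and ?e = "Some (m, Suc j) :: var"
  have X: "alg_indep g ?X"
    using alg_indep_mono[OF alg_indep_fam[of m L], of ?X] assms
    by (subst alg_indep_cong[of _ _ "fam m"]) (auto simp: g_def Xvars_def)
  have gX: "g v = fam m v" if "v \<in> ?X" for v
    using that by (auto simp: g_def Xvars_def)
  have "Fd (g ` ?X) \<subseteq> Fd (gv ` ?X)"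
    using assms fam_mem[of m L] by (intro Fd_mono) (auto simp: gX)
  then have "alg_indep g (insert None ?X)"
    using Transc_ehom_row[of m L n] assms n
    by (intro alg_indep_insertI X) (auto simp: g_def t_def Xvars_def elim: Transc_mono)
  moreover have "insert None ?X = insert ?e (insert None ?X - {?e})"
    using assms by (auto simp: Xvars_def)
  ultimately have "alg_indep g (insert ?e (insert None ?X - {?e}))" by metis
  then have "Transc (g ?e) (Fd (g ` (insert None ?X - {?e})))" (is "Transc _ ?K")
    by (rule alg_indep_insertD) auto
  moreover have "g ?e = xv m (Suc j)"
    using assms by (auto simp: g_def fam_def top_cols_def)
  moreover have "Fd (gens L m \<union> {t} \<union> {xv m b | b. Suc j < b \<and> b \<le> n}) \<subseteq> ?K"
  proof (rule Fd_mono, intro Un_least)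
    let ?R = "fam m ` {Some (i, b) | i b. Some (i, b) \<in> ?X \<and> (m < i \<or> i + b \<le> Suc n)}"
    have "?R \<subseteq> ?K"
    proof
      fix f assume "f \<in> ?R"
      then obtain i b where "f = g (Some (i, b))" "Some (i, b) \<in> ?X" "m < i \<or> i + b \<le> Suc n"
        using gX by auto
      then show "f \<in> ?K" using assms by (auto simp: top_cols_def intro!: Fd.gen imageI)
    qed
    then show "gens L m \<subseteq> ?K"
      using gens_subset_fam[of m L] Rg_least[OF subring_Fd] assms by (meson Suc_leD subset_trans)
    show "{t} \<subseteq> ?K"
      using image_eqI[of t g None] by (auto simp: g_def intro!: Fd.gen)
    show "{xv m b | b. Suc j < b \<and> b \<le> n} \<subseteq> ?K"
    proof clarify
      fix b assume b: "Suc j < b" "b \<le> n"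
      then have "xv m b = g (Some (m, b))" using assms by (auto simp: g_def fam_def top_cols_def)
      moreover have "Some (m, b) \<in> insert None ?X - {?e}" using b assms by (auto simp: Xvars_def)
      ultimately have "xv m b \<in> g ` (insert None ?X - {?e})" by (rule image_eqI)
      then show "xv m b \<in> ?K" by (rule Fd.gen)
    qed
  qed
  ultimately show ?thesis unfolding t_def by (simp only:) (rule Transc_mono)
qed

text \<open>The recursion from t_{b+1} to t_b puts all t_b with b > j into the field
  \<open>G\<close> generated by F_m, t_n and the x_m^b with b > j + 1. It also shows t_j to be
  affine over \<open>G\<close> in x_m^{j+1}, which is transcendental over \<open>G\<close>; the
  slope is nonzero because t_{j+1} is not in C(x).\<close>

lemma Transc_crystal_row:
  assumes "1 \<le> m" "Suc m \<le> L" "j \<in> top_cols (Suc m)"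
  shows "Transc (ehom n m (xv (Suc m) j))
    (Fd (gens L m \<union> (\<lambda>b. ehom n m (xv (Suc m) b)) ` {b\<in>top_cols (Suc m). Suc j \<le> b}))"
proof -
  define t where "t b = ehom n m (xv (Suc m) b)" for b
  let ?u = "xv m" and ?v = "xv (Suc m)"
  have sub: "Fd (gens L m) \<subseteq> Fd (gv ` Xvars L n)"
    using gens_subset_Rg[of m L] Rg_subset_Fd assms by (intro Fd_mono) force
  have j: "1 \<le> j" "j \<le> n" using assms by (auto simp: top_cols_def)
  show ?thesis
  proof (cases "j = n")
    case True
    have "{b \<in> top_cols (Suc m). Suc n \<le> b} = {}" by (auto simp: top_cols_def)
    moreover have "Transc (ehom n m (xv (Suc m) n)) (Fd (gens L m))"
      using Transc_mono[OF Transc_ehom_row[of m L n] sub] assms n by simp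
    ultimately show ?thesis unfolding True by (simp only: image_empty Un_empty_right)
  next
    case False
    define G where "G = Fd (gens L m \<union> {t n} \<union> {?u b | b. Suc j < b \<and> b \<le> n})"
    have v: "?v b \<in> Fd (gv ` Xvars L n)" "?v b \<in> G" if "1 \<le> b" "b \<le> n" for b
    proof -
      show "?v b \<in> Fd (gv ` Xvars L n)" using that assms by (intro xv_mem) auto
      show "?v b \<in> G" unfolding G_def using that assms by (intro Fd.gen UnI1 gens_xv) auto
    qed
    have t: "t b \<noteq> 0" "t b \<noteq> ?v b" if "1 \<le> b" "b \<le> n" for b
      using v[OF that] Transc_notin[OF Transc_ehom_row[of m L b] subring_Fd] that assms
        ehom_eq_0[OF n, of m "?v b"] by (auto simp: t_def)
    \<comment> \<open>The image of x_m^{b+1} is eliminated between the preserved product in column b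
      + 1 and the preserved sum.\<close>
    have rec: "t b = ((t (Suc b) - ?v (Suc b)) / t (Suc b)) * ?u (Suc b) + ?v b" if "1 \<le> b" "b < n" for b
    proof -
      have "ehom n m (?u (Suc b)) = ?u (Suc b) * ?v (Suc b) / t (Suc b)"
        using ehom_row_prod[OF assms(1), of "Suc b"] t[of "Suc b"] that
        by (simp add: t_def field_simps)
      then have "t b = ?v b + ?u (Suc b) - ?u (Suc b) * ?v (Suc b) / t (Suc b)"
        using ehom_row_sum[OF assms(1) that] by (simp add: t_def algebra_simps)
      also have "\<dots> = ((t (Suc b) - ?v (Suc b)) / t (Suc b)) * ?u (Suc b) + ?v b"
        using t[of "Suc b"] that by (simp add: field_simps)
      finally show ?thesis .
    qed
    have tG: "t b \<in> G" if "b \<le> n" "Suc j \<le> b" for b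
      using that
    proof (induction b rule: inc_induct)
      case base
      show ?case by (auto simp: G_def intro: Fd.gen)
    next
      case (step b)
      have "?u (Suc b) \<in> G" using step unfolding G_def by (intro Fd.gen) auto
      moreover have "t (Suc b) \<in> G" using step by auto
      ultimately show ?case
        using rec[of b] v[of b] v[of "Suc b"] step j by (simp add: G_def Fd_intros Fd_divide)
    qed
    have "Transc (?u (Suc j)) G"
      using Transc_row[OF assms] False j by (simp add: G_def t_def)
    moreover have "(t (Suc j) - ?v (Suc j)) / t (Suc j) \<in> G" "?v j \<in> G" "(t (Suc j) - ?v (Suc j)) / t (Suc j) \<noteq> 0"
      using tG[of "Suc j"] v[of "Suc j"] v[of j] t[of "Suc j"] j False
      by (auto simp: G_def intro!: Fd_divide Fd_intros)
    ultimately have "Transc (t j) G"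
      unfolding rec[OF j(1) le_neq_implies_less[OF j(2) False]] G_def by (intro Transc_affine)
    moreover have "Fd (gens L m \<union> t ` {b\<in>top_cols (Suc m). Suc j \<le> b}) \<subseteq> G"
      unfolding G_def
    proof (rule Fd_mono)
      show "gens L m \<union> t ` {b\<in>top_cols (Suc m). Suc j \<le> b} \<subseteq>
          Fd (gens L m \<union> {t n} \<union> {?u b | b. Suc j < b \<and> b \<le> n})"
        using tG unfolding G_def by (auto simp: top_cols_def intro: Fd.gen)
    qed
    ultimately show ?thesis unfolding t_def by (rule Transc_mono)
  qed
qed

lemma invariant_step:
  assumes "1 \<le> m" "Suc m \<le> L" "f \<in> Fd (gens L m)" "ehom n m f = f"
  shows "f \<in> Fd (gens L (Suc m))"
proof -
  define t where "t b = ehom n m (xv (Suc m) b)" for b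
  let ?S = "gens L (Suc m)"
  have "f \<in> Fd (?S \<union> xv (Suc m) ` top_cols (Suc m))"
    using Fd_mono[OF gens_step[OF assms(2)]] assms(3) by blast
  then have "f \<in> Fd (ehom n m ` (?S \<union> xv (Suc m) ` top_cols (Suc m)))"
    using ehom_Fd[OF n assms(1)] assms(4) by metis
  moreover have "ehom n m ` (?S \<union> xv (Suc m) ` top_cols (Suc m)) \<subseteq> ?S \<union> t ` top_cols (Suc m)"
  proof -
    have "ehom n m s = s" if "s \<in> ?S" for s
      using that assms(1) ehom_row(3)[OF assms(1)] ehom_Z[OF assms(1), of "Suc m"]
      by (auto simp: gens_def)
    then show ?thesis by (auto simp: t_def)
  qed
  ultimately have start: "f \<in> Fd (?S \<union> t ` top_cols (Suc m))"
    by (meson Fd_mono Fd.gen subset_iff)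
  \<comment> \<open>The t_j are removed by increasing j, because each is transcendental over F_m
    together with those of larger index.\<close>
  have "f \<in> Fd (?S \<union> t ` {b\<in>top_cols (Suc m). j \<le> b})" if "1 \<le> j" "j \<le> Suc n" for j
    using that
  proof (induction j rule: dec_induct)
    case base
    have "{b\<in>top_cols (Suc m). 1 \<le> b} = top_cols (Suc m)" by (auto simp: top_cols_def)
    then show ?case using start by simp
  next
    case (step j)
    let ?T = "\<lambda>j. t ` {b\<in>top_cols (Suc m). j \<le> b}"
    show ?case
    proof (cases "j \<in> top_cols (Suc m)")
      case False
      then have "?T (Suc j) = ?T j" by (auto simp: Suc_le_eq order.strict_iff_order)
      then show ?thesis using step by simp
    next
      case True
      then have "?T j = insert (t j) (?T (Suc j))" by (auto simp: Suc_le_eq order.strict_iff_order)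
      then have "f \<in> Fd (insert (t j) (?S \<union> ?T (Suc j)))" using step by simp
      moreover have "Transc (t j) (Fd (gens L m \<union> ?T (Suc j)))"
        using Transc_crystal_row[OF assms(1,2) True] by (simp add: t_def)
      moreover have "Fd (?S \<union> ?T (Suc j)) \<subseteq> Fd (gens L m \<union> ?T (Suc j))"
      proof (rule Fd_mono, intro Un_least)
        have "s \<in> Fd (gens L m \<union> ?T (Suc j))" if "s \<in> ?S" for s
        proof -
          have Zm: "Z m a b \<in> Fd (gens L m \<union> ?T (Suc j))" if "1 \<le> a" "a \<le> n" "1 \<le> b" for a b
          proof (cases "b \<le> n")
            case True
            then show ?thesis using that by (intro Fd.gen UnI1 gens_Z)
          qed (use that in \<open>simp add: Wprod_beyond Fd_intros\<close>)
          from that consider a b where "s = Z (Suc m) a b" "1 \<le> a" "a \<le> n" "1 \<le> b" "b \<le> n"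
            | i j where "s = xv i j" "Suc m < i" "i \<le> L" "1 \<le> j" "j \<le> n" by (auto simp: gens_def)
          then show ?thesis
          proof cases
            case 1
            then have "xv (Suc m) b \<in> Fd (gens L m \<union> ?T (Suc j))"
              using assms(2) by (intro Fd.gen UnI1 gens_xv) auto
            with 1 Zm[of a b] Zm[of a "Suc b"] show ?thesis
              by (simp add: Wprod_Suc Fd_intros)
          next
            case 2
            then show ?thesis by (simp only:) (intro Fd.gen UnI1 gens_xv, auto)
          qed
        qed
        then show "?S \<subseteq> Fd (gens L m \<union> ?T (Suc j))" by blast
      qed (auto intro: Fd.gen)
      moreover have "f \<in> Fd (gens L m \<union> ?T (Suc j))"
        using assms(3) Fd_mono[of "gens L m" "gens L m \<union> ?T (Suc j)"] Fd.gen by blast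
      ultimately show ?thesis using Fd_insert_const[OF _ subring_Fd] by blast
    qed
  qed
  from this[of "Suc n"] have "f \<in> Fd (?S \<union> t ` {b\<in>top_cols (Suc m). Suc n \<le> b})" by simp
  moreover have "{b\<in>top_cols (Suc m). Suc n \<le> b} = {}" by (auto simp: top_cols_def)
  ultimately show ?thesis by simp
qed

section \<open>Polynomial invariants\<close>

lemma Transc_fam:
  assumes "m \<le> L" "v \<in> Xvars L n" "S \<subseteq> Rg (fam m ` (Xvars L n - {v}))"
  shows "Transc (fam m v) (Fd S)"
proof -
  have "alg_indep (fam m) (insert v (Xvars L n - {v}))"
    by (rule alg_indep_mono[OF alg_indep_fam[OF assms(1)]]) (use assms(2) in auto)
  then have "Transc (fam m v) (Fd (fam m ` (Xvars L n - {v})))"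
    by (rule alg_indep_insertD) auto
  then show ?thesis using Fd_Rg_mono[OF assms(3)] by (rule Transc_mono)
qed

text \<open>e_m fixes F_{m+1} elementwise, so a relation for x_{m+1}^b passes to its image, which is
  transcendental over C(x).\<close>

lemma Transc_next_row:
  assumes "1 \<le> m" "Suc m \<le> L" "1 \<le> b" "b \<le> n"
  shows "Transc (xv (Suc m) b) (Fd (gens L (Suc m)))"
  unfolding Transc_def
proof (intro ballI impI)
  fix p assume p: "p \<in> Pol (Fd (gens L (Suc m)))" "poly p (xv (Suc m) b) = 0"
  note h = rhom_ehom[OF n assms(1)]
  have "ehom n m s = s" if "s \<in> gens L (Suc m)" for s
    using that assms(1) ehom_row(3)[OF assms(1)] ehom_Z[OF assms(1), of "Suc m"]
    by (auto simp: gens_def)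
  note gens_fixed = this
  have fixed: "ehom n m s = s" if "s \<in> Fd (gens L (Suc m))" for s
    using that by induction (auto simp: gens_fixed ehom_cst[OF n assms(1)] ehom_inverse[OF n assms(1)] rhom_add[OF h] rhom_mult[OF h])
  have "ehom n m (poly p (xv (Suc m) b)) = poly p (ehom n m (xv (Suc m) b))"
    using p(1) by (induction p) (auto simp: Pol_pCons fixed rhom_0[OF h] rhom_add[OF h] rhom_mult[OF h])
  then have "poly p (ehom n m (xv (Suc m) b)) = 0" by (simp add: p(2) rhom_0[OF h])
  moreover have "Fd (gens L (Suc m)) \<subseteq> Fd (gv ` Xvars L n)"
    using assms by (intro Fd_Rg_mono gens_subset_Rg)
  ultimately show "p = 0"
    using Transc_ehom_row[OF assms] Transc_mono TranscD p(1) by blast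
qed

text \<open>
  The generators of F_m and of F_{m+1} that belong to the columns b, ..., n; they are compared by
  descending induction on b.
\<close>

definition right_old :: "nat \<Rightarrow> nat \<Rightarrow> nat \<Rightarrow> rfun set" where
  "right_old L m b = {xv i j | i j. Suc m < i \<and> i \<le> L \<and> 1 \<le> j \<and> j \<le> n} \<union>
     {Z m a j | a j. 1 \<le> a \<and> a \<le> n \<and> b \<le> j \<and> j \<le> n} \<union> {xv (Suc m) j | j. b \<le> j \<and> j \<le> n}"

definition right_new :: "nat \<Rightarrow> nat \<Rightarrow> nat \<Rightarrow> rfun set" where
  "right_new L m b = {xv i j | i j. Suc m < i \<and> i \<le> L \<and> 1 \<le> j \<and> j \<le> n} \<union>
     {Z (Suc m) a j | a j. 1 \<le> a \<and> a \<le> n \<and> b \<le> j \<and> j \<le> n}"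

lemma right_old_column:
  assumes "b \<le> n"
  shows "right_old L m b = insert (xv (Suc m) b) (right_old L m (Suc b)) \<union> (\<lambda>a. Z m a b) ` {1..n}"
proof -
  have *: "b \<le> j \<and> j \<le> n \<longleftrightarrow> j = b \<or> Suc b \<le> j \<and> j \<le> n" for j using assms by auto
  have "(\<lambda>a. Z m a b) ` {1..n} = {Z m a j | a j. 1 \<le> a \<and> a \<le> n \<and> j = b}" by auto
  moreover have "{Z m a j | a j. 1 \<le> a \<and> a \<le> n \<and> (j = b \<or> Suc b \<le> j \<and> j \<le> n)} =
      {Z m a j | a j. 1 \<le> a \<and> a \<le> n \<and> j = b} \<union> {Z m a j | a j. 1 \<le> a \<and> a \<le> n \<and> Suc b \<le> j \<and> j \<le> n}"
    by blast
  moreover have "{xv (Suc m) j | j. j = b \<or> Suc b \<le> j \<and> j \<le> n} =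
      insert (xv (Suc m) b) {xv (Suc m) j | j. Suc b \<le> j \<and> j \<le> n}"
    by blast
  ultimately show ?thesis
    unfolding right_old_def * by (simp only: Un_insert_left Un_insert_right Un_ac)
qed

lemma right_new_column:
  assumes "b \<le> n"
  shows "right_new L m b = right_new L m (Suc b) \<union> (\<lambda>a. Z (Suc m) a b) ` {1..n}"
proof -
  have *: "b \<le> j \<and> j \<le> n \<longleftrightarrow> j = b \<or> Suc b \<le> j \<and> j \<le> n" for j using assms by auto
  have "(\<lambda>a. Z (Suc m) a b) ` {1..n} = {Z (Suc m) a j | a j. 1 \<le> a \<and> a \<le> n \<and> j = b}" by auto
  then show ?thesis unfolding right_new_def * by blast
qed

lemma right_old_fam:
  assumes "Suc m \<le> L" "1 \<le> b" "\<And>i j. m < i \<Longrightarrow> i \<le> L \<Longrightarrow> b < j \<or> Suc m < i \<Longrightarrow> 1 \<le> j \<Longrightarrow> j \<le> n \<Longrightarrow> Some (i, j) \<in> V"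
    and "\<And>i j. 1 \<le> i \<Longrightarrow> i \<le> m \<Longrightarrow> b < j \<Longrightarrow> j \<le> n \<Longrightarrow> Some (i, j) \<in> V"
  shows "right_old L m (Suc b) \<subseteq> Rg (fam m ` V)"
  unfolding right_old_def using assms by (auto intro!: xv_fam Z_fam)

lemma Z_right:
  assumes "1 \<le> a" "a \<le> n" "1 \<le> b"
  shows "Z m a (Suc b) \<in> Rg (right_old L m (Suc b))"
proof (cases "Suc b \<le> n")
  case True
  then show ?thesis using assms by (intro Rg.gen) (auto simp: right_old_def)
qed (use assms in \<open>simp add: Wprod_beyond Rg_intros\<close>)

text \<open>Prepares column b for division by v = x_{m+1}^b. If there is a new entry z = v + \<rho>
  in row b + m, with \<rho> from column b + 1, then v and z generate the same ring over the older
  generators; otherwise v is just a free variable.\<close>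

lemma saturated_column_unit:
  assumes m: "1 \<le> m" "Suc m \<le> L" and b: "1 \<le> b" "b \<le> n"
    and sat: "saturated 1 (right_old L m (Suc b)) (right_new L m (Suc b))"
  shows "saturated (xv (Suc m) b) (insert (xv (Suc m) b) (right_old L m (Suc b)))
    (if b + m \<le> n then insert (Z (Suc m) (b + m) b) (right_new L m (Suc b)) else right_new L m (Suc b))"
proof -
  let ?v = "xv (Suc m) b" and ?D = "right_old L m (Suc b)" and ?E = "right_new L m (Suc b)"
  have "Transc (fam m (Some (Suc m, b))) (Fd ?D)"
    using m b by (intro Transc_fam[of m L] right_old_fam) (auto simp: Xvars_def)
  then have v: "Transc ?v (Fd ?D)" by (simp add: fam_def)
  show ?thesis
  proof (cases "b + m \<le> n")
    case False
    then show ?thesis using saturated_insert_unit[OF sat v] by simp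
  next
    case True
    let ?z = "Z (Suc m) (b + m) b" and ?r = "Z m (b + m) (Suc b)"
    have z: "?z = ?v + ?r" using True b by (simp add: Wprod_Suc Wprod_one)
    have r: "?r \<in> Rg ?D" using True b by (intro Z_right) auto
    have E: "Fd ?E \<subseteq> Fd (gens L (Suc m))"
      by (rule Fd_mono) (auto simp: right_new_def gens_def intro!: Fd.gen)
    have "?z \<in> Fd (gens L (Suc m))" using True b by (intro Fd.gen gens_Z) auto
    \<comment> \<open>\<rho> = z - v is an affine function of v over F_{m+1}, which contains
      z.\<close>
    then have "Transc (- 1 * ?v + ?z) (Fd (gens L (Suc m)))"
      using Transc_next_row[OF m b] by (intro Transc_affine) (auto intro: Fd_intros)
    then have "Transc ?r (Fd ?E)" using E by (simp add: z Transc_mono)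
    moreover have "Transc ?z (Fd ?D)"
      using Transc_affine[OF v, of 1 ?r] r Rg_subset_Fd by (auto simp: z intro: Fd_intros)
    ultimately have "saturated (?z - ?r) (insert ?z ?D) (insert ?z ?E)"
      using sat r by (intro saturated_insert_shift)
    moreover have "Rg (insert ?z ?D) = Rg (insert ?v ?D)"
    proof -
      have D: "Rg ?D \<subseteq> Rg (insert s ?D)" for s by (rule Rg_mono) (auto intro: Rg.gen)
      have "?z - ?r \<in> Rg (insert ?z ?D)" "?v + ?r \<in> Rg (insert ?v ?D)"
        using r D[of ?z] D[of ?v] by (auto intro!: Rg_intros intro: Rg.gen)
      then have "?v \<in> Rg (insert ?z ?D)" "?z \<in> Rg (insert ?v ?D)" by (simp_all add: z)
      then show ?thesis by (intro subset_antisym Rg_mono) (auto intro: Rg.gen)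
    qed
    ultimately show ?thesis using True by (simp add: saturated_def z)
  qed
qed

lemma saturated_column:
  assumes m: "1 \<le> m" "Suc m \<le> L" and b: "1 \<le> b" "b \<le> n"
    and sat: "saturated 1 (right_old L m (Suc b)) (right_new L m (Suc b))"
  shows "saturated 1 (right_old L m b) (right_new L m b)"
proof -
  let ?v = "xv (Suc m) b" and ?D = "right_old L m (Suc b)" and ?E = "right_new L m (Suc b)"
  define C where "C = (if b + m \<le> n then insert (Z (Suc m) (b + m) b) ?E else ?E)"
  define A' where "A' a = insert ?v ?D \<union> (\<lambda>a. Z m a b) ` {1..a}" for a
  define C' where "C' a = C \<union> (\<lambda>a. Z (Suc m) a b) ` {1..a}" for a
  have "saturated ?v (A' a) (C' a)" if "a \<le> n" for a
    using that
  proof (induction a)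
    case 0
    then show ?case using saturated_column_unit[OF assms] by (simp add: A'_def C'_def C_def)
  next
    case (Suc a)
    then have IH: "saturated ?v (A' a) (C' a)" by simp
    have A: "A' (Suc a) = insert (Z m (Suc a) b) (A' a)" and C: "C' (Suc a) = insert (Z (Suc m) (Suc a) b) (C' a)"
      by (auto simp: A'_def C'_def atLeastAtMostSuc_conv)
    show ?case
    proof (cases "b \<le> Suc a \<and> Suc a < b + m")
      case True
      let ?e = "Some (Suc (Suc a) - b, b) :: var" and ?V = "Xvars L n"
      have e: "?e \<in> ?V" using True m b Suc.prems by (auto simp: Xvars_def)
      have "A' a \<subseteq> Rg (fam m ` (?V - {?e}))"
        unfolding A'_def using True m b Suc.prems
        by (intro Un_least insert_subsetI right_old_fam image_subsetI xv_fam Z_fam) (auto simp: Xvars_def)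
      then have "Transc (fam m ?e) (Fd (A' a))" using m e by (intro Transc_fam[of m L]) auto
      moreover have "fam m ?e = Z m (Suc a) b" using True Suc.prems by (auto simp: fam_def)
      ultimately have "Transc (Z m (Suc a) b) (Fd (A' a))" by simp
      moreover have "Z m (Suc a) (Suc b) \<in> Rg (A' a)"
        using Z_right[of "Suc a" b m L] Suc.prems b Rg_mono[of ?D "A' a"] by (auto simp: A'_def intro: Rg.gen)
      ultimately show ?thesis
        unfolding A C Wprod_Suc[OF Suc.prems b(1)] by (intro saturated_insert_affine IH xv_nonzero)
    next
      case False
      \<comment> \<open>Outside the band the old entry is 0 or 1, and the new one is 0, 1 or, in row
        b + m, the generator already put into \<open>C\<close>.\<close>
      have "Z m (Suc a) b \<in> Rg (A' a)"
        using False Suc.prems b Wprod_zero[of "Suc a" n b m xv] Wprod_one[of "Suc a" n b m xv]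
        by (cases "Suc a = b + m") (auto intro: Rg_intros)
      moreover have "Z (Suc m) (Suc a) b \<in> Rg (C' a)"
      proof (cases "Suc a = b + m")
        case True
        then show ?thesis using Suc.prems by (auto simp: C'_def C_def intro!: Rg.gen)
      next
        case ne: False
        then show ?thesis
          using False Suc.prems b Wprod_zero[of "Suc a" n b "Suc m" xv] Wprod_one[of "Suc a" n b "Suc m" xv]
          by (cases "Suc a = b + Suc m") (auto intro: Rg_intros)
      qed
      ultimately show ?thesis unfolding A C by (intro saturated_insert_absorb IH)
    qed
  qed
  then have "saturated 1 (A' n) (C' n)" using saturated_1 by blast
  moreover have "A' n = right_old L m b"
    using right_old_column[OF b(2)] by (simp add: A'_def)
  moreover have "C' n = right_new L m b"
  proof -
    have "Z (Suc m) (b + m) b \<in> (\<lambda>a. Z (Suc m) a b) ` {1..n}" if "b + m \<le> n"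
      using that b by (intro image_eqI[of _ _ "b + m"]) auto
    then show ?thesis unfolding right_new_column[OF b(2)] C'_def C_def by auto
  qed
  ultimately show ?thesis by simp
qed

lemma polynomial_step:
  assumes "1 \<le> m" "Suc m \<le> L" "f \<in> Fd (gens L (Suc m))" "f \<in> Rg (gens L m)"
  shows "f \<in> Rg (gens L (Suc m))"
proof -
  have "saturated 1 (right_old L m b) (right_new L m b)" if "b \<le> Suc n" "1 \<le> b" for b
    using that
  proof (induction b rule: inc_induct)
    case base
    \<comment> \<open>Beyond the last column only the variables of the rows after m + 1 remain, on
      both sides.\<close>
    have "right_old L m (Suc n) = right_new L m (Suc n)" by (auto simp: right_old_def right_new_def)
    moreover have "Rg (right_new L m (Suc n)) = Fd (right_new L m (Suc n)) \<inter> Rg (right_new L m (Suc n))"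
      using Rg_subset_Fd by blast
    ultimately show ?case by (simp add: saturated_def Rg_intros subsetI Rg.gen)
  next
    case (step b)
    then show ?case using assms(1,2) by (intro saturated_column[of m L b]) simp_all
  qed
  from this[of 1] have "saturated 1 (right_old L m 1) (right_new L m 1)" by simp
  moreover have "right_old L m 1 = gens L m"
  proof -
    have *: "m < i \<and> i \<le> L \<and> 1 \<le> j \<and> j \<le> n \<longleftrightarrow>
        Suc m < i \<and> i \<le> L \<and> 1 \<le> j \<and> j \<le> n \<or> i = Suc m \<and> 1 \<le> j \<and> j \<le> n" for i j
      using assms(2) by auto
    have "{xv i j | i j. m < i \<and> i \<le> L \<and> 1 \<le> j \<and> j \<le> n} =
        {xv i j | i j. Suc m < i \<and> i \<le> L \<and> 1 \<le> j \<and> j \<le> n} \<union> {xv (Suc m) j | j. 1 \<le> j \<and> j \<le> n}"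
      unfolding * by blast
    then show ?thesis unfolding right_old_def gens_def by (simp only: Un_ac)
  qed
  moreover have "right_new L m 1 = gens L (Suc m)"
    unfolding right_new_def gens_def by (rule Un_commute)
  ultimately have "saturated 1 (gens L m) (gens L (Suc m))" by simp
  from saturatedD[OF this assms(3), of 0] assms(4) show ?thesis by simp
qed

section \<open>Climbing the tower to the invariants\<close>

lemma Rg_gens_1:
  assumes "1 \<le> L"
  shows "Rg (gens L 1) = PolR L n"
  unfolding PolR_eq
proof (intro subset_antisym Rg_mono)
  show "gens L 1 \<subseteq> Rg (gv ` Xvars L n)" using assms by (rule gens_subset_Rg)
  show "gv ` Xvars L n \<subseteq> Rg (gens L 1)"
  proof
    fix s assume "s \<in> gv ` Xvars L n"
    then obtain i j where s: "s = xv i j" "1 \<le> i" "i \<le> L" "1 \<le> j" "j \<le> n"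
      by (auto simp: Xvars_def xv_def)
    show "s \<in> Rg (gens L 1)"
    proof (cases "i = 1")
      case True
      then have "s = Z 1 j j" using s Wprod_Suc[of j n j xv 0] by simp
      then show ?thesis using s by (simp only:) (intro Rg.gen gens_Z)
    next
      case False
      then show ?thesis using s by (simp only:) (intro Rg.gen gens_xv, auto)
    qed
  qed
qed

lemma Fd_gens_1: "1 \<le> L \<Longrightarrow> Fd (gens L 1) = RatF L n"
  using Rg_gens_1[of L] unfolding RatF_eq PolR_eq Fd_eq_quotients by simp

lemma gens_subset_RatF: "m \<le> L \<Longrightarrow> Fd (gens L m) \<subseteq> RatF L n"
  unfolding RatF_eq by (intro Fd_Rg_mono gens_subset_Rg)

lemma Inv_e_eq:
  assumes "1 \<le> m"
  shows "Inv_e m n = Fd (gens m m)"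
proof
  have "f \<in> Fd (gens m k)" if f: "f \<in> Inv_e m n" and "1 \<le> k" "k \<le> m" for f k
    using that(2,3)
  proof (induction k rule: dec_induct)
    case base
    show ?case using f Fd_gens_1[OF assms] by (simp add: Inv_e_def)
  next
    case (step k)
    then have "ehom n k f = f"
      using f e_invariant_iff[OF n, of k f m] by (auto simp: Inv_e_def)
    then show ?case using step by (intro invariant_step) auto
  qed
  then show "Inv_e m n \<subseteq> Fd (gens m m)" using assms by blast
  show "Fd (gens m m) \<subseteq> Inv_e m n"
  proof
    fix f assume f: "f \<in> Fd (gens m m)"
    then have fR: "f \<in> RatF m n" using gens_subset_RatF by blast
    have "ehom n i f = f" if i: "1 \<le> i" "i \<le> m - 1" for i
      using f
    proof induction
      case (gen s)
      then show ?case using i ehom_Z[of i m] by (auto simp: gens_def)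
    qed (auto simp: ehom_cst[OF n i(1)] ehom_inverse[OF n i(1)]
        rhom_add[OF rhom_ehom[OF n i(1)]] rhom_mult[OF rhom_ehom[OF n i(1)]])
    then show "f \<in> Inv_e m n"
      using fR e_invariant_iff[OF n _ fR] by (auto simp: Inv_e_def)
  qed
qed

lemma Inv_e_polynomial:
  assumes "1 \<le> m"
  shows "Inv_e m n \<inter> PolR m n = Rg (gens m m)"
proof
  \<comment> \<open>\<open>polynomial_step\<close> also asks for membership in the intermediate
    fields, which decrease along the tower.\<close>
  have sub: "Fd (gens m m) \<subseteq> Fd (gens m k)" if "1 \<le> k" "k \<le> m" for k
    using that(2,1)
  proof (induction k rule: inc_induct)
    case (step k)
    have "gens m (Suc k) \<subseteq> Fd (gens m k)"
    proof
      fix s assume "s \<in> gens m (Suc k)"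
      then consider a b where "s = Z (Suc k) a b" "1 \<le> a" "a \<le> n" "1 \<le> b" "b \<le> n"
        | i j where "s = xv i j" "Suc k < i" "i \<le> m" "1 \<le> j" "j \<le> n" by (auto simp: gens_def)
      then show "s \<in> Fd (gens m k)"
      proof cases
        case 1
        have "xv (Suc k) b \<in> Fd (gens m k)" "Z k a b \<in> Fd (gens m k)"
          using 1 step by (auto intro!: Fd.gen gens_xv gens_Z)
        moreover have "Z k a (Suc b) \<in> Fd (gens m k)"
          using 1 by (cases "Suc b \<le> n") (auto simp: Wprod_beyond intro!: Fd_intros Fd.gen gens_Z)
        ultimately show ?thesis using 1 by (simp add: Wprod_Suc Fd_intros)
      next
        case 2
        then show ?thesis by (simp only:) (intro Fd.gen gens_xv, auto)
      qed
    qed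
    then show ?case using step.IH step.hyps Fd_mono[of "gens m (Suc k)" "gens m k"] that by auto
  qed auto
  have "f \<in> Rg (gens m k)" if f: "f \<in> Inv_e m n \<inter> PolR m n" and "1 \<le> k" "k \<le> m" for f k
    using that(2,3)
  proof (induction k rule: dec_induct)
    case base
    show ?case using f Rg_gens_1[OF assms] by simp
  next
    case (step k)
    have "f \<in> Fd (gens m (Suc k))" using f sub[of "Suc k"] step by (auto simp: Inv_e_eq[OF assms])
    then show ?case using step by (intro polynomial_step) auto
  qed
  then show "Inv_e m n \<inter> PolR m n \<subseteq> Rg (gens m m)" using assms by blast
  have "Rg (gens m m) \<subseteq> PolR m n" unfolding PolR_eq by (intro Rg_mono gens_subset_Rg) simp
  then show "Rg (gens m m) \<subseteq> Inv_e m n \<inter> PolR m n"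
    using Rg_subset_Fd by (auto simp: Inv_e_eq[OF assms])
qed

text \<open>An entry inside the band belongs to an algebraically independent family, so it is
  transcendental over \<open>Fd {}\<close>, the field of constants, which contains 0 and 1.\<close>

lemma nontriv_eq: "nontriv m n = {(a, b). 1 \<le> b \<and> b \<le> a \<and> a \<le> n \<and> a < b + m}"
proof -
  have "Z m a b \<noteq> 0 \<and> Z m a b \<noteq> 1" if ab: "1 \<le> b" "b \<le> a" "a \<le> n" "a < b + m" for a b
  proof -
    let ?e = "Some (Suc a - b, b) :: var"
    have "Transc (fam m ?e) (Fd {})"
      using ab by (intro Transc_fam[of m m]) (auto simp: Xvars_def)
    moreover have "fam m ?e = Z m a b" using ab by (auto simp: fam_def)
    ultimately have "Z m a b \<notin> Fd {}" using Transc_notin[OF _ subring_Fd] by metis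
    then show ?thesis using Fd_intros(2,3) by metis
  qed
  moreover have "1 \<le> b \<and> b \<le> a \<and> a \<le> n \<and> a < b + m"
    if ab: "1 \<le> b" "a \<le> n" "Z m a b \<noteq> 0" "Z m a b \<noteq> 1" for a b
  proof -
    have "\<not> (a < b \<or> b + m < a)" "a \<noteq> b + m"
      using ab Wprod_zero[of a n b m xv] Wprod_one[of a n b m xv] by auto
    then show ?thesis using ab by auto
  qed
  ultimately have "1 \<le> a \<and> a \<le> n \<and> 1 \<le> b \<and> b \<le> n \<and> Z m a b \<noteq> 0 \<and> Z m a b \<noteq> 1 \<longleftrightarrow>
      1 \<le> b \<and> b \<le> a \<and> a \<le> n \<and> a < b + m" for a b
    by (meson le_trans)
  then show ?thesis unfolding nontriv_def Mx_def by auto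
qed

lemma Rg_gens_nontriv: "Rg ((\<lambda>(a, b). Mx m n a b) ` nontriv m n) = Rg (gens m m)"
proof (intro subset_antisym Rg_mono)
  show "(\<lambda>(a, b). Mx m n a b) ` nontriv m n \<subseteq> Rg (gens m m)"
    unfolding nontriv_def Mx_def by (auto intro!: Rg.gen gens_Z)
  show "gens m m \<subseteq> Rg ((\<lambda>(a, b). Mx m n a b) ` nontriv m n)"
  proof
    fix s assume "s \<in> gens m m"
    then obtain a b where s: "s = Mx m n a b" "1 \<le> a" "a \<le> n" "1 \<le> b" "b \<le> n"
      by (auto simp: gens_def Mx_def)
    show "s \<in> Rg ((\<lambda>(a, b). Mx m n a b) ` nontriv m n)"
    proof (cases "s = 0 \<or> s = 1")
      case False
      then have "(a, b) \<in> nontriv m n" using s by (auto simp: nontriv_def)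
      then show ?thesis unfolding s(1) by (intro Rg.gen image_eqI[of _ _ "(a, b)"]) simp_all
    qed (auto intro: Rg_intros)
  qed
qed

lemma alg_indep_nontriv: "alg_indep (\<lambda>(a, b). Mx m n a b) (nontriv m n)"
proof -
  \<comment> \<open>The position of the variable that the entry (a, b) replaces in
    \<open>fam m\<close>.\<close>
  define f where "f = (\<lambda>(a, b). Some (Suc a - b, b) :: var)"
  have "finite (nontriv m n)"
    by (rule finite_subset[of _ "{1..n} \<times> {1..n}"]) (auto simp: nontriv_def)
  moreover have "inj_on f (nontriv m n)" unfolding nontriv_eq by (auto simp: f_def inj_on_def)
  moreover have "alg_indep (fam m) (f ` nontriv m n)"
    by (rule alg_indep_mono[OF alg_indep_fam[of m m]]) (auto simp: nontriv_eq f_def Xvars_def)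
  ultimately have "alg_indep (\<lambda>e. fam m (f e)) (nontriv m n)" using alg_indep_reindex[of "fam m" f "nontriv m n"] by blast
  moreover have "fam m (f e) = (case e of (a, b) \<Rightarrow> Mx m n a b)" if "e \<in> nontriv m n" for e
    using that by (auto simp: nontriv_eq f_def fam_def Mx_def)
  ultimately show ?thesis using alg_indep_cong[of "nontriv m n" "\<lambda>e. fam m (f e)"] by blast
qed

end

theorem theorem1p1:
  fixes m n :: nat
  assumes "m \<ge> 1" and "n \<ge> 1"
  shows "alg_indep (\<lambda>(a, b). Mx m n a b) (nontriv m n)
       \<and> gen_field (\<lambda>(a, b). Mx m n a b) (nontriv m n) = Inv_e m n
       \<and> gen_ring (\<lambda>(a, b). Mx m n a b) (nontriv m n) = Inv_e m n \<inter> PolR m n"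
proof -
  interpret crystal n by standard (rule assms(2))
  have "Fd ((\<lambda>(a, b). Mx m n a b) ` nontriv m n) = Fd (gens m m)"
    using Rg_gens_nontriv[of m] by (simp add: Fd_eq_quotients)
  then show ?thesis
    using alg_indep_nontriv Rg_gens_nontriv[of m] Inv_e_eq[OF assms(1)] Inv_e_polynomial[OF assms(1)]
    by (simp add: gen_field_eq_Fd gen_ring_eq_Rg)
qed

end
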